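(* Let $\Phi:[0,\infty)\to(-\infty,\infty]$ be a convex function which may take the value $\infty$ only at $0$. If $\Phi$ satisfies the growth condition and $M_\Phi^{\mathrm{adm}}\neq\emptyset$, then $$C_\Phi^{\mathrm{adm}}=\overline{C^{\mathrm{adm}}}^{\sigma(E_\Phi,F_\Phi)}.$$
   Context: $(\Omega,\mathcal F,(\mathcal F_t)_{t\in[0,T]},\mathbb P)$ is a filtered probability space satisfying the usual conditions, with finite horizon $T$, and $S=(S_t)_{t\in[0,T]}$ is an $\mathbb R^d$-valued semimartingale. An $\mathbb R^d$-valued predictable process $H$ is admissible if it is $S$-integrable and there is a constant $c\ge0$ such that for all $t\in[0,T]$, $\int_0^tH_u\,dS_u\ge-c$ $\mathbb P$-a.s. Put $K^{\mathrm{adm}}:=\{\int_0^TH_u\,dS_u:H\text{ admissible}\}$, a wedge in $L^0$ (a wedge is a non-empty convex set closed under multiplication by scalars $\lambda\ge0$). $L^0=L^0(\Omega,\mathcal F,\mathbb P)$ is the vector lattice of real random variables modulo $\mathbb P$-a.s. equality, $L^0_+$ its non-negative elements. For a probability measure $\mathbb Q\ll\mathbb P$, $L^1(\mathbb Q)$ is regarded as the set of $X\in L^0$ with $\mathbb E_{\mathbb Q}|X|<\infty$, and $L^1_+(\mathbb Q)$ is its subset of non-negative elements. $M_1^{\mathrm{adm}}$ is the set of all probability measures $\mathbb Q\ll\mathbb P$ with $K^{\mathrm{adm}}\subseteq L^1(\mathbb Q)$ and $\mathbb E_{\mathbb Q}[X]\le0$ for all $X\in K^{\mathrm{adm}}$.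 With $\Phi^+=\max\{\Phi,0\}$, $M_\Phi^{\mathrm{adm}}:=\{\mathbb Q\in M_1^{\mathrm{adm}}:\mathbb E_{\mathbb P}[\Phi^+(\frac{d\mathbb Q}{d\mathbb P})]<\infty\}$. Growth condition on $\Phi$: for every interval $[\lambda_0,\lambda_1]\subseteq(0,\infty)$ there exist $\alpha>0$, $\beta>0$ such that $\Phi^+(\lambda y)\le\alpha\Phi^+(y)+\beta(y+1)$ for all $y>0$ and all $\lambda\in[\lambda_0,\lambda_1]$. $E_\Phi:=\bigcap_{\mathbb Q\in M_\Phi^{\mathrm{adm}}}L^1(\mathbb Q)$; $F_\Phi\subseteq L^1(\mathbb P)$ is the linear span of $\{\frac{d\mathbb Q}{d\mathbb P}:\mathbb Q\in M_\Phi^{\mathrm{adm}}\}$; $\sigma(E_\Phi,F_\Phi)$ is the weak topology on $E_\Phi$ induced by the bilinear form $\langle z,w\rangle=\mathbb E_{\mathbb P}[zw]$ (not necessarily Hausdorff). $C^{\mathrm{adm}}:=(K^{\mathrm{adm}}-L^0_+)\cap L^\infty(\mathbb P)$, and $C_\Phi^{\mathrm{adm}}:=\bigcap_{\mathbb Q\in M_\Phi^{\mathrm{adm}}}\overline{K^{\mathrm{adm}}-L^1_+(\mathbb Q)}^{L^1(\mathbb Q)}\subseteq E_\Phi$, where the closure consists of all $X\in L^1(\mathbb Q)$ for which there are $X_n\in K^{\mathrm{adm}}-L^1_+(\mathbb Q)$ with $\mathbb E_{\mathbb Q}|X-X_n|\to0$. *)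

theory Defs
  imports "HOL-Probability.Probability"
begin

section \<open>Processes on a filtered probability space with time set [0,T]\<close>

text \<open>
  A process is a function of time and state; only its values on [0,T] and on the space of
  the probability measure matter.  The filtration is a family of sub-sigma-algebras, also
  used on [0,T] only.
\<close>

definition usual_conditions :: "'a measure \<Rightarrow> (real \<Rightarrow> 'a measure) \<Rightarrow> real \<Rightarrow> bool" where
  "usual_conditions P F T \<longleftrightarrow>
     prob_space P \<and> complete_measure P \<and>
     (\<forall>t\<in>{0..T}. subalgebra P (F t)) \<and>
     (\<forall>s\<in>{0..T}. \<forall>t\<in>{s..T}. sets (F s) \<subseteq> sets (F t)) \<and>
     (\<forall>s\<in>{0..<T}. sets (F s) = (\<Inter>t\<in>{s<..T}. sets (F t))) \<and>
     null_sets P \<subseteq> sets (F 0)"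

definition cadlag_on :: "real \<Rightarrow> (real \<Rightarrow> 'b::topological_space) \<Rightarrow> bool" where
  "cadlag_on T f \<longleftrightarrow>
     (\<forall>t\<in>{0..<T}. (f \<longlongrightarrow> f t) (at_right t)) \<and>
     (\<forall>t\<in>{0<..T}. \<exists>l. (f \<longlongrightarrow> l) (at_left t))"

definition adapted_cadlag ::
  "'a measure \<Rightarrow> (real \<Rightarrow> 'a measure) \<Rightarrow> real \<Rightarrow> (real \<Rightarrow> 'a \<Rightarrow> 'b::euclidean_space) \<Rightarrow> bool" where
  "adapted_cadlag P F T X \<longleftrightarrow>
     (\<forall>t\<in>{0..T}. X t \<in> borel_measurable (F t)) \<and>
     (\<forall>\<omega>\<in>space P. cadlag_on T (\<lambda>t. X t \<omega>))"

definition martingale ::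
  "'a measure \<Rightarrow> (real \<Rightarrow> 'a measure) \<Rightarrow> real \<Rightarrow> (real \<Rightarrow> 'a \<Rightarrow> real) \<Rightarrow> bool" where
  "martingale P F T X \<longleftrightarrow>
     (\<forall>t\<in>{0..T}. X t \<in> borel_measurable (F t) \<and> integrable P (X t)) \<and>
     (\<forall>s\<in>{0..T}. \<forall>t\<in>{s..T}. AE \<omega> in P. real_cond_exp P (F s) (X t) \<omega> = X s \<omega>)"

text \<open>
  On a finite horizon the localizing stopping times take values in [0,T] and are almost
  surely eventually equal to T.  Clamping the index makes the library's notion of stopping
  time, whose time set is the whole real line, refer to the filtration on [0,T].
\<close>

definition local_martingale ::
  "'a measure \<Rightarrow> (real \<Rightarrow> 'a measure) \<Rightarrow> real \<Rightarrow> (real \<Rightarrow> 'a \<Rightarrow> real) \<Rightarrow> bool" where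
  "local_martingale P F T X \<longleftrightarrow>
     adapted_cadlag P F T X \<and>
     (\<exists>\<tau>. (\<forall>n. stopping_time (\<lambda>t. F (max 0 (min t T))) (\<tau> n)) \<and>
          (\<forall>n. \<forall>\<omega>\<in>space P. 0 \<le> \<tau> n \<omega> \<and> \<tau> n \<omega> \<le> \<tau> (Suc n) \<omega> \<and> \<tau> n \<omega> \<le> T) \<and>
          (AE \<omega> in P. \<forall>\<^sub>F n in sequentially. \<tau> n \<omega> = T) \<and>
          (\<forall>n::nat. martingale P F T (\<lambda>t \<omega>. X (min t (\<tau> n \<omega>)) \<omega> - X 0 \<omega>)))"

definition finite_variation_on :: "real \<Rightarrow> (real \<Rightarrow> real) \<Rightarrow> bool" where
  "finite_variation_on T f \<longleftrightarrow>
     (\<exists>B. \<forall>(n::nat) p. mono p \<longrightarrow> range p \<subseteq> {0..T} \<longrightarrow> (\<Sum>i<n. \<bar>f (p (Suc i)) - f (p i)\<bar>) \<le> B)"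

definition real_semimartingale ::
  "'a measure \<Rightarrow> (real \<Rightarrow> 'a measure) \<Rightarrow> real \<Rightarrow> (real \<Rightarrow> 'a \<Rightarrow> real) \<Rightarrow> bool" where
  "real_semimartingale P F T X \<longleftrightarrow>
     adapted_cadlag P F T X \<and>
     (\<exists>N A. local_martingale P F T N \<and>
            adapted_cadlag P F T A \<and> (\<forall>\<omega>\<in>space P. finite_variation_on T (\<lambda>t. A t \<omega>)) \<and>
            (AE \<omega> in P. \<forall>t\<in>{0..T}. X t \<omega> = X 0 \<omega> + N t \<omega> + A t \<omega>))"

definition semimartingale ::
  "'a measure \<Rightarrow> (real \<Rightarrow> 'a measure) \<Rightarrow> real \<Rightarrow> (real \<Rightarrow> 'a \<Rightarrow> real ^ 'd) \<Rightarrow> bool" where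
  "semimartingale P F T S \<longleftrightarrow> (\<forall>j. real_semimartingale P F T (\<lambda>t \<omega>. S t \<omega> $ j))"

definition predictable_sigma :: "'a measure \<Rightarrow> (real \<Rightarrow> 'a measure) \<Rightarrow> real \<Rightarrow> (real \<times> 'a) measure" where
  "predictable_sigma P F T = sigma ({0..T} \<times> space P)
     ({{0} \<times> A | A. A \<in> sets (F 0)} \<union>
      {{s<..u} \<times> A | s u A. 0 \<le> s \<and> s \<le> u \<and> u \<le> T \<and> A \<in> sets (F s)})"

definition predictable ::
  "'a measure \<Rightarrow> (real \<Rightarrow> 'a measure) \<Rightarrow> real \<Rightarrow> (real \<Rightarrow> 'a \<Rightarrow> 'b::euclidean_space) \<Rightarrow> bool" where
  "predictable P F T H \<longleftrightarrow> (\<lambda>(t, \<omega>). H t \<omega>) \<in> borel_measurable (predictable_sigma P F T)"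


section \<open>The stochastic integral\<close>

text \<open>
  The integral is constructed in the usual three steps: elementary integrands, bounded
  predictable integrands (by the bounded convergence theorem), general integrands (by
  convergence in the semimartingale topology).  Each step is a relation between an integrand
  and a version of its integral process; for a semimartingale the integral process is unique
  up to indistinguishability.  Integrals are over (0,t], so the value of an integrand at time
  0 does not contribute.
\<close>

inductive elementary_integral ::
  "'a measure \<Rightarrow> (real \<Rightarrow> 'a measure) \<Rightarrow> real \<Rightarrow> (real \<Rightarrow> 'a \<Rightarrow> 'b::euclidean_space) \<Rightarrow>
   (real \<Rightarrow> 'a \<Rightarrow> 'b) \<Rightarrow> (real \<Rightarrow> 'a \<Rightarrow> real) \<Rightarrow> bool"
  for P F T S where
  at_zero:
    "h \<in> borel_measurable (F 0) \<Longrightarrow> \<forall>\<omega>\<in>space P. norm (h \<omega>) \<le> c \<Longrightarrow>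
     elementary_integral P F T S (\<lambda>t \<omega>. if t = 0 then h \<omega> else 0) (\<lambda>t \<omega>. 0)"
| step:
    "0 \<le> s \<Longrightarrow> s \<le> u \<Longrightarrow> u \<le> T \<Longrightarrow> h \<in> borel_measurable (F s) \<Longrightarrow> \<forall>\<omega>\<in>space P. norm (h \<omega>) \<le> c \<Longrightarrow>
     elementary_integral P F T S (\<lambda>t \<omega>. if s < t \<and> t \<le> u then h \<omega> else 0)
       (\<lambda>t \<omega>. h \<omega> \<bullet> (S (min t u) \<omega> - S (min t s) \<omega>))"
| add:
    "elementary_integral P F T S H X \<Longrightarrow> elementary_integral P F T S G Y \<Longrightarrow>
     elementary_integral P F T S (\<lambda>t \<omega>. H t \<omega> + G t \<omega>) (\<lambda>t \<omega>. X t \<omega> + Y t \<omega>)"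

definition ucp_tendsto ::
  "'a measure \<Rightarrow> real \<Rightarrow> (nat \<Rightarrow> real \<Rightarrow> 'a \<Rightarrow> real) \<Rightarrow> (real \<Rightarrow> 'a \<Rightarrow> real) \<Rightarrow> bool" where
  "ucp_tendsto P T X Y \<longleftrightarrow>
     (\<forall>\<epsilon>>0. (\<lambda>n. measure P {\<omega>\<in>space P. \<exists>t\<in>{0..T}. \<epsilon> < \<bar>X n t \<omega> - Y t \<omega>\<bar>}) \<longlonglongrightarrow> 0)"

inductive bounded_integral ::
  "'a measure \<Rightarrow> (real \<Rightarrow> 'a measure) \<Rightarrow> real \<Rightarrow> (real \<Rightarrow> 'a \<Rightarrow> 'b::euclidean_space) \<Rightarrow>
   (real \<Rightarrow> 'a \<Rightarrow> 'b) \<Rightarrow> (real \<Rightarrow> 'a \<Rightarrow> real) \<Rightarrow> bool"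
  for P F T S where
  elementary:
    "elementary_integral P F T S H X \<Longrightarrow> bounded_integral P F T S H X"
| limit:
    "(\<And>n::nat. bounded_integral P F T S (H n) (X n)) \<Longrightarrow>
     (\<forall>n. \<forall>t\<in>{0..T}. \<forall>\<omega>\<in>space P. norm (H n t \<omega>) \<le> c) \<Longrightarrow>
     (\<forall>t\<in>{0..T}. \<forall>\<omega>\<in>space P. (\<lambda>n. H n t \<omega>) \<longlonglongrightarrow> G t \<omega>) \<Longrightarrow>
     adapted_cadlag P F T Y \<Longrightarrow> ucp_tendsto P T X Y \<Longrightarrow>
     bounded_integral P F T S G Y"

text \<open>
  Convergence in the semimartingale (Emery) topology: the elementary integrals of the
  differences, with integrands K bounded by 1, tend to 0 in ucp uniformly in K.  As these
  integrals do not see the initial value, it is added separately.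
\<close>

definition emery_tendsto ::
  "'a measure \<Rightarrow> (real \<Rightarrow> 'a measure) \<Rightarrow> real \<Rightarrow> (nat \<Rightarrow> real \<Rightarrow> 'a \<Rightarrow> real) \<Rightarrow>
   (real \<Rightarrow> 'a \<Rightarrow> real) \<Rightarrow> bool" where
  "emery_tendsto P F T X Y \<longleftrightarrow>
     (\<forall>\<epsilon>>0. \<forall>\<^sub>F n in sequentially. \<forall>K Z.
        elementary_integral P F T (\<lambda>t \<omega>. X n t \<omega> - Y t \<omega>) K Z \<longrightarrow>
        (\<forall>t\<in>{0..T}. \<forall>\<omega>\<in>space P. \<bar>K t \<omega>\<bar> \<le> 1) \<longrightarrow>
        measure P {\<omega>\<in>space P. \<exists>t\<in>{0..T}. \<epsilon> < \<bar>X n 0 \<omega> - Y 0 \<omega>\<bar> + \<bar>Z t \<omega>\<bar>} < \<epsilon>)"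

text \<open>
  H is S-integrable with integral process X (Chou-Meyer-Stricker): some bounded predictable
  processes converge pointwise to H, and their integrals converge to X in the semimartingale
  topology.  The truncations of H at level n are one admissible choice whenever there is any.
\<close>

definition stochastic_integral ::
  "'a measure \<Rightarrow> (real \<Rightarrow> 'a measure) \<Rightarrow> real \<Rightarrow> (real \<Rightarrow> 'a \<Rightarrow> 'b::euclidean_space) \<Rightarrow>
   (real \<Rightarrow> 'a \<Rightarrow> 'b) \<Rightarrow> (real \<Rightarrow> 'a \<Rightarrow> real) \<Rightarrow> bool" where
  "stochastic_integral P F T S H X \<longleftrightarrow>
     predictable P F T H \<and> adapted_cadlag P F T X \<and>
     (\<exists>Hn Xn. (\<forall>n::nat. bounded_integral P F T S (Hn n) (Xn n)) \<and>
        (\<forall>t\<in>{0..T}. \<forall>\<omega>\<in>space P. (\<lambda>n. Hn n t \<omega>) \<longlonglongrightarrow> H t \<omega>) \<and>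
        emery_tendsto P F T Xn X)"

text \<open>H is admissible, and X is its integral process.\<close>

definition admissible_integral ::
  "'a measure \<Rightarrow> (real \<Rightarrow> 'a measure) \<Rightarrow> real \<Rightarrow> (real \<Rightarrow> 'a \<Rightarrow> 'b::euclidean_space) \<Rightarrow>
   (real \<Rightarrow> 'a \<Rightarrow> 'b) \<Rightarrow> (real \<Rightarrow> 'a \<Rightarrow> real) \<Rightarrow> bool" where
  "admissible_integral P F T S H X \<longleftrightarrow>
     stochastic_integral P F T S H X \<and> (\<exists>c\<ge>0. \<forall>t\<in>{0..T}. AE \<omega> in P. X t \<omega> \<ge> - c)"


section \<open>Claims, pricing measures and the topology\<close>

text \<open>
  Elements of L0 are represented by measurable functions.  All sets of random variables below
  are closed under P-almost sure equality, so they are the preimages of the corresponding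
  sets of equivalence classes.
\<close>

definition L0 :: "'a measure \<Rightarrow> ('a \<Rightarrow> real) set" where
  "L0 P = borel_measurable P"

definition L0_plus :: "'a measure \<Rightarrow> ('a \<Rightarrow> real) set" where
  "L0_plus P = {X \<in> L0 P. AE \<omega> in P. 0 \<le> X \<omega>}"

definition L_infty :: "'a measure \<Rightarrow> ('a \<Rightarrow> real) set" where
  "L_infty P = {X \<in> L0 P. \<exists>c. AE \<omega> in P. \<bar>X \<omega>\<bar> \<le> c}"

definition L1 :: "'a measure \<Rightarrow> 'a measure \<Rightarrow> ('a \<Rightarrow> real) set" where
  "L1 P Q = {X \<in> L0 P. integrable Q X}"

definition L1_plus :: "'a measure \<Rightarrow> 'a measure \<Rightarrow> ('a \<Rightarrow> real) set" where
  "L1_plus P Q = L1 P Q \<inter> L0_plus P"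

definition rv_diff :: "('a \<Rightarrow> real) set \<Rightarrow> ('a \<Rightarrow> real) set \<Rightarrow> ('a \<Rightarrow> real) set" where
  "rv_diff A B = {(\<lambda>\<omega>. X \<omega> - Y \<omega>) | X Y. X \<in> A \<and> Y \<in> B}"

definition K_adm ::
  "'a measure \<Rightarrow> (real \<Rightarrow> 'a measure) \<Rightarrow> real \<Rightarrow> (real \<Rightarrow> 'a \<Rightarrow> real ^ 'd) \<Rightarrow> ('a \<Rightarrow> real) set" where
  "K_adm P F T S =
     {Z \<in> L0 P. \<exists>H X. admissible_integral P F T S H X \<and> (AE \<omega> in P. Z \<omega> = X T \<omega>)}"

definition M1_adm ::
  "'a measure \<Rightarrow> (real \<Rightarrow> 'a measure) \<Rightarrow> real \<Rightarrow> (real \<Rightarrow> 'a \<Rightarrow> real ^ 'd) \<Rightarrow> 'a measure set" where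
  "M1_adm P F T S =
     {Q. prob_space Q \<and> sets Q = sets P \<and> absolutely_continuous P Q \<and>
         K_adm P F T S \<subseteq> L1 P Q \<and> (\<forall>X\<in>K_adm P F T S. (\<integral>\<omega>. X \<omega> \<partial>Q) \<le> 0)}"

definition density_of :: "'a measure \<Rightarrow> 'a measure \<Rightarrow> 'a \<Rightarrow> real" where
  "density_of P Q \<omega> = enn2real (RN_deriv P Q \<omega>)"

definition pos_part :: "(real \<Rightarrow> ereal) \<Rightarrow> real \<Rightarrow> ereal" where
  "pos_part \<Phi> y = max (\<Phi> y) 0"

definition M_Phi ::
  "'a measure \<Rightarrow> (real \<Rightarrow> 'a measure) \<Rightarrow> real \<Rightarrow> (real \<Rightarrow> 'a \<Rightarrow> real ^ 'd) \<Rightarrow> (real \<Rightarrow> ereal) \<Rightarrow>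
   'a measure set" where
  "M_Phi P F T S \<Phi> =
     {Q \<in> M1_adm P F T S. (\<integral>\<^sup>+\<omega>. e2ennreal (pos_part \<Phi> (density_of P Q \<omega>)) \<partial>P) < \<infinity>}"

definition growth_condition :: "(real \<Rightarrow> ereal) \<Rightarrow> bool" where
  "growth_condition \<Phi> \<longleftrightarrow>
     (\<forall>l0 l1. 0 < l0 \<and> l0 \<le> l1 \<longrightarrow>
        (\<exists>\<alpha>>0. \<exists>\<beta>>0. \<forall>y>0. \<forall>l\<in>{l0..l1}.
           pos_part \<Phi> (l * y) \<le> ereal \<alpha> * pos_part \<Phi> y + ereal (\<beta> * (y + 1))))"

text \<open>
  A convex function from the nonnegative reals to the reals extended by +infinity that may be
  infinite only at 0.  Values at negative arguments are irrelevant.  In ereal, 0 times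
  infinity is 0.
\<close>

definition penalty_function :: "(real \<Rightarrow> ereal) \<Rightarrow> bool" where
  "penalty_function \<Phi> \<longleftrightarrow>
     (\<forall>y\<ge>0. \<Phi> y \<noteq> -\<infinity>) \<and> (\<forall>y>0. \<Phi> y \<noteq> \<infinity>) \<and>
     (\<forall>x\<ge>0. \<forall>y\<ge>0. \<forall>u\<in>{0..1}.
        \<Phi> (u * x + (1 - u) * y) \<le> ereal u * \<Phi> x + ereal (1 - u) * \<Phi> y)"

definition E_Phi ::
  "'a measure \<Rightarrow> (real \<Rightarrow> 'a measure) \<Rightarrow> real \<Rightarrow> (real \<Rightarrow> 'a \<Rightarrow> real ^ 'd) \<Rightarrow> (real \<Rightarrow> ereal) \<Rightarrow>
   ('a \<Rightarrow> real) set" where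
  "E_Phi P F T S \<Phi> = (\<Inter>Q\<in>M_Phi P F T S \<Phi>. L1 P Q)"

definition F_Phi ::
  "'a measure \<Rightarrow> (real \<Rightarrow> 'a measure) \<Rightarrow> real \<Rightarrow> (real \<Rightarrow> 'a \<Rightarrow> real ^ 'd) \<Rightarrow> (real \<Rightarrow> ereal) \<Rightarrow>
   ('a \<Rightarrow> real) set" where
  "F_Phi P F T S \<Phi> =
     {w \<in> L1 P P. \<exists>(n::nat) a Q. (\<forall>i<n. Q i \<in> M_Phi P F T S \<Phi>) \<and>
        (AE \<omega> in P. w \<omega> = (\<Sum>i<n. a i * density_of P (Q i) \<omega>))}"

text \<open>The initial topology on E for the maps sending z to the P-expectation of z w, with w in F.\<close>

definition weak_topology ::
  "'a measure \<Rightarrow> ('a \<Rightarrow> real) set \<Rightarrow> ('a \<Rightarrow> real) set \<Rightarrow> ('a \<Rightarrow> real) topology" where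
  "weak_topology P E F =
     pullback_topology E (\<lambda>z. \<lambda>w\<in>F. \<integral>\<omega>. z \<omega> * w \<omega> \<partial>P) (product_topology (\<lambda>_. euclideanreal) F)"

definition C_adm ::
  "'a measure \<Rightarrow> (real \<Rightarrow> 'a measure) \<Rightarrow> real \<Rightarrow> (real \<Rightarrow> 'a \<Rightarrow> real ^ 'd) \<Rightarrow> ('a \<Rightarrow> real) set" where
  "C_adm P F T S = rv_diff (K_adm P F T S) (L0_plus P) \<inter> L_infty P"

definition L1_closure :: "'a measure \<Rightarrow> 'a measure \<Rightarrow> ('a \<Rightarrow> real) set \<Rightarrow> ('a \<Rightarrow> real) set" where
  "L1_closure P Q A =
     {X \<in> L1 P Q. \<exists>Xn. (\<forall>n::nat. Xn n \<in> A) \<and> (\<lambda>n. \<integral>\<omega>. \<bar>X \<omega> - Xn n \<omega>\<bar> \<partial>Q) \<longlonglongrightarrow> 0}"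

definition C_Phi ::
  "'a measure \<Rightarrow> (real \<Rightarrow> 'a measure) \<Rightarrow> real \<Rightarrow> (real \<Rightarrow> 'a \<Rightarrow> real ^ 'd) \<Rightarrow> (real \<Rightarrow> ereal) \<Rightarrow>
   ('a \<Rightarrow> real) set" where
  "C_Phi P F T S \<Phi> =
     (\<Inter>Q\<in>M_Phi P F T S \<Phi>. L1_closure P Q (rv_diff (K_adm P F T S) (L1_plus P Q)))"

end

theory Submission
  imports Defs "HOL-Library.Function_Algebras"
begin

text \<open>
  If X lies outside the L1(Q)-closure of K - L1_+(Q) for some pricing measure Q, Hahn-Banach gives a
  bounded density, nonnegative because the cone contains - L1_+(Q), that is at most 0 on the
  cone and positive at X.  Adding a small constant bounds it away from 0, so by the growth
  condition the normalized measure R is again in M_Phi, and the density of R separates X weakly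
  from C_adm.  Conversely, a weak neighbourhood involves only finitely many pricing measures; they
  are all dominated by a multiple of one of their mixtures Q, which is in M_Phi by convexity, so
  L1(Q)-approximation suffices, and truncation turns elements of K - L1_+(Q) into elements of C_adm
  because admissible claims are bounded below.
\<close>

section \<open>Adapted cadlag processes\<close>

text \<open>The stochastic integral is only a relation between integrands and processes, so the cone
  property of \<open>K_adm\<close> has to be carried through elementary, bounded and general
  integrands. The obstacle there is measurability: Emery convergence speaks of
  \<open>measure P\<close> of events with an uncountable quantifier over time, and union bounds for
  them become available only after cadlag paths reduce the quantifier to countably many times.
  Positivity of the separating functional lets its values on indicators form a measure, so
  Radon-Nikodym gives the density without signed measures. The lower bound on that density is forced
  by the growth condition, which controls \<Phi> only for factors in compact subintervals of the
  open half-line; the added constant respects the inequalities on claims because the original Q is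
  itself a pricing measure. In the converse direction L1(Q)-approximants depend on Q, so one Q must
  serve all coordinates of a neighbourhood at once.\<close>

lemma cadlag_on_const [simp]: "cadlag_on T (\<lambda>t. c)"
  by (auto simp: cadlag_on_def)

lemma cadlag_on_add:
  fixes f g :: "real \<Rightarrow> 'b::real_normed_vector"
  assumes "cadlag_on T f" "cadlag_on T g"
  shows "cadlag_on T (\<lambda>t. f t + g t)"
  using assms unfolding cadlag_on_def by (blast intro: tendsto_add)

lemma cadlag_on_compose:
  assumes "cadlag_on T f" "\<And>x. isCont g x"
  shows "cadlag_on T (\<lambda>t. g (f t))"
  using assms unfolding cadlag_on_def by (blast intro: isCont_tendsto_compose)

text \<open>At \<open>t = u\<close> the two sides differ: just after \<open>u\<close> the stopped
  path is already frozen at \<open>f u\<close>, just before it still follows \<open>f\<close>. Hence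
  the split \<open>t < u\<close> for right limits and \<open>t \<le> u\<close> for left
  limits.\<close>

lemma cadlag_on_min:
  assumes "cadlag_on T f"
  shows "cadlag_on T (\<lambda>t. f (min t u))"
  unfolding cadlag_on_def
proof (intro conjI ballI)
  fix t assume t: "t \<in> {0..<T}"
  show "((\<lambda>t. f (min t u)) \<longlongrightarrow> f (min t u)) (at_right t)"
  proof (cases "t < u")
    case True
    have "\<forall>\<^sub>F x in at_right t. f x = f (min x u)"
      using eventually_at_right_real[OF True] by eventually_elim auto
    moreover have "(f \<longlongrightarrow> f t) (at_right t)"
      using assms t by (auto simp: cadlag_on_def)
    ultimately show ?thesis
      using True by (auto intro: Lim_transform_eventually)
  next
    case False
    have "\<forall>\<^sub>F x in at_right t. f u = f (min x u)"
      using eventually_at_right_less by eventually_elim (use False in auto)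
    then show ?thesis
      using False by (auto intro: Lim_transform_eventually[OF tendsto_const])
  qed
next
  fix t assume t: "t \<in> {0<..T}"
  show "\<exists>l. ((\<lambda>t. f (min t u)) \<longlongrightarrow> l) (at_left t)"
  proof (cases "t \<le> u")
    case True
    obtain l where "(f \<longlongrightarrow> l) (at_left t)"
      using assms t unfolding cadlag_on_def by blast
    moreover have "\<forall>\<^sub>F x in at_left t. f x = f (min x u)"
      using eventually_at_left_real[of "t - 1" t] by (auto elim!: eventually_mono simp: min_def) (use True in auto)
    ultimately show ?thesis
      by (blast intro: Lim_transform_eventually)
  next
    case False
    then have "u < t" by simp
    have "\<forall>\<^sub>F x in at_left t. f u = f (min x u)"
      using eventually_at_left_real[OF \<open>u < t\<close>] by eventually_elim auto
    then show ?thesis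
      by (blast intro: Lim_transform_eventually[OF tendsto_const])
  qed
qed

text \<open>Right-continuity carries a strict excess at \<open>t < T\<close> to a rational time
  between \<open>t\<close> and \<open>T\<close>. The endpoint \<open>T\<close> may be irrational and
  has no later times in the horizon, so it joins the countable index set separately.\<close>

lemma cadlag_exceeds_iff:
  fixes f :: "real \<Rightarrow> real"
  assumes "cadlag_on T f" "0 \<le> T"
  shows "(\<exists>t\<in>{0..T}. e < f t) \<longleftrightarrow> (\<exists>t\<in>({0..T} \<inter> \<rat>) \<union> {T}. e < f t)"
proof
  assume "\<exists>t\<in>{0..T}. e < f t"
  then obtain t where t: "t \<in> {0..T}" "e < f t" by blast
  show "\<exists>t\<in>({0..T} \<inter> \<rat>) \<union> {T}. e < f t"
  proof (cases "t = T")
    case False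
    with t have "t < T" and "(f \<longlongrightarrow> f t) (at_right t)"
      using assms by (auto simp: cadlag_on_def)
    then have "\<forall>\<^sub>F s in at_right t. e < f s"
      using t by (auto dest: order_tendstoD)
    then obtain b where b: "t < b" "\<And>s. t < s \<Longrightarrow> s < b \<Longrightarrow> e < f s"
      unfolding eventually_at_right_field by auto
    obtain q where q: "q \<in> \<rat>" "t < q" "q < min b T"
      using Rats_dense_in_real[of t "min b T"] b \<open>t < T\<close> by auto
    then have "q \<in> {0..T} \<inter> \<rat>" "e < f q"
      using t b by auto
    then show ?thesis by blast
  qed (use t in auto)
qed (use assms in auto)

text \<open>\<open>measure P\<close> is 0 outside \<open>sets P\<close>, so monotonicity and
  subadditivity of probabilities need these events to be measurable; the countable form of the
  quantifier over time provides that.\<close>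

lemma adapted_cadlag_exceeds_sets:
  assumes "usual_conditions P F T" "0 \<le> T" "adapted_cadlag P F T X"
  shows "{\<omega>\<in>space P. \<exists>t\<in>{0..T}. (e::real) < X t \<omega>} \<in> sets P"
proof -
  let ?D = "({0..T} \<inter> \<rat>) \<union> {T}"
  have "countable ?D"
    by (simp add: countable_rat countable_Int2)
  moreover have "{\<omega>\<in>space P. e < X t \<omega>} \<in> sets P" if "t \<in> ?D" for t
  proof -
    from that have t: "t \<in> {0..T}" using assms by auto
    then have "subalgebra P (F t)" "X t \<in> borel_measurable (F t)"
      using assms by (auto simp: usual_conditions_def adapted_cadlag_def)
    then have "X t \<in> borel_measurable P"
      by (rule measurable_from_subalg)
    then show ?thesis by measurable
  qed
  ultimately have "(\<Union>t\<in>?D. {\<omega>\<in>space P. e < X t \<omega>}) \<in> sets P"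
    by (intro sets.countable_UN'') auto
  also have "(\<Union>t\<in>?D. {\<omega>\<in>space P. e < X t \<omega>}) = {\<omega>\<in>space P. \<exists>t\<in>?D. e < X t \<omega>}"
    by blast
  also have "\<dots> = {\<omega>\<in>space P. \<exists>t\<in>{0..T}. e < X t \<omega>}"
    using assms(2,3) cadlag_exceeds_iff[of T "\<lambda>t. X t _" e]
    by (intro Collect_cong conj_cong refl) (auto simp: adapted_cadlag_def)
  finally show ?thesis .
qed

lemma filtration_measurable_mono:
  assumes "usual_conditions P F T" "0 \<le> s" "s \<le> t" "t \<le> T" "h \<in> borel_measurable (F s)"
  shows "h \<in> borel_measurable (F t)"
proof -
  have "subalgebra (F t) (F s)"
    using assms by (auto simp: usual_conditions_def subalgebra_def)
  then show ?thesis
    using assms(5) measurable_from_subalg by blast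
qed

lemma adapted_cadlag_add:
  fixes X Y :: "real \<Rightarrow> 'a \<Rightarrow> 'b::euclidean_space"
  assumes "adapted_cadlag P F T X" "adapted_cadlag P F T Y"
  shows "adapted_cadlag P F T (\<lambda>t \<omega>. X t \<omega> + Y t \<omega>)"
  using assms unfolding adapted_cadlag_def
  by (intro conjI ballI cadlag_on_add borel_measurable_add) auto

lemma adapted_cadlag_compose:
  fixes g :: "'b::euclidean_space \<Rightarrow> 'c::euclidean_space"
  assumes "adapted_cadlag P F T X" "\<And>x. isCont g x"
  shows "adapted_cadlag P F T (\<lambda>t \<omega>. g (X t \<omega>))"
proof -
  have "g \<in> borel_measurable borel"
    using assms(2) by (intro borel_measurable_continuous_onI) (simp add: continuous_at_imp_continuous_on)
  then show ?thesis
    using assms by (auto simp: adapted_cadlag_def intro: cadlag_on_compose measurable_compose)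
qed

lemma adapted_cadlag_minus:
  fixes X Y :: "real \<Rightarrow> 'a \<Rightarrow> 'b::euclidean_space"
  assumes "adapted_cadlag P F T X" "adapted_cadlag P F T Y"
  shows "adapted_cadlag P F T (\<lambda>t \<omega>. X t \<omega> - Y t \<omega>)"
  using adapted_cadlag_add[OF assms(1) adapted_cadlag_compose[OF assms(2), of uminus]] by simp

lemma adapted_cadlag_const:
  assumes "usual_conditions P F T" "h \<in> borel_measurable (F 0)"
  shows "adapted_cadlag P F T (\<lambda>t. h)"
  using filtration_measurable_mono[OF assms(1) _ _ _ assms(2)]
  by (auto simp: adapted_cadlag_def)

lemma semimartingale_adapted_cadlag:
  fixes S :: "real \<Rightarrow> 'a \<Rightarrow> real ^ 'd"
  assumes "semimartingale P F T S"
  shows "adapted_cadlag P F T S"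
proof -
  have S: "adapted_cadlag P F T (\<lambda>t \<omega>. S t \<omega> $ j)" for j
    using assms by (auto simp: semimartingale_def real_semimartingale_def)
  show ?thesis
    unfolding adapted_cadlag_def cadlag_on_def
  proof (intro conjI ballI)
    fix t assume "t \<in> {0..T}"
    then show "S t \<in> borel_measurable (F t)"
      using S by (subst borel_measurable_euclidean_space)
        (auto simp: adapted_cadlag_def Basis_vec_def inner_axis)
  next
    fix \<omega> t assume "\<omega> \<in> space P" "t \<in> {0..<T}"
    then show "((\<lambda>t. S t \<omega>) \<longlongrightarrow> S t \<omega>) (at_right t)"
      using S by (intro vec_tendstoI) (auto simp: adapted_cadlag_def cadlag_on_def)
  next
    fix \<omega> t assume "\<omega> \<in> space P" "t \<in> {0<..T}"
    then have "\<exists>l. ((\<lambda>t. S t \<omega> $ j) \<longlongrightarrow> l) (at_left t)" for j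
      using S by (auto simp: adapted_cadlag_def cadlag_on_def)
    then obtain l where "\<And>j. ((\<lambda>t. S t \<omega> $ j) \<longlongrightarrow> l j) (at_left t)"
      by metis
    then have "((\<lambda>t. S t \<omega>) \<longlongrightarrow> (\<chi> j. l j)) (at_left t)"
      by (intro vec_tendstoI) auto
    then show "\<exists>l. ((\<lambda>t. S t \<omega>) \<longlongrightarrow> l) (at_left t)"
      by blast
  qed
qed


section \<open>The claims attainable by admissible strategies form a convex cone\<close>

lemma elementary_integral_adapted_cadlag:
  assumes "elementary_integral P F T S H X" "usual_conditions P F T" "adapted_cadlag P F T S"
  shows "adapted_cadlag P F T X"
  using assms(1)
proof induction
  case (at_zero h c)
  then show ?case
    by (auto simp: adapted_cadlag_def)
next
  case (step s u h c)
  have "(\<lambda>\<omega>. h \<omega> \<bullet> (S (min t u) \<omega> - S (min t s) \<omega>)) \<in> borel_measurable (F t)"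
    if t: "t \<in> {0..T}" for t
  \<comment> \<open>\<open>h\<close> is known to be measurable for \<open>F s\<close>, which says
    nothing about an earlier \<open>F t\<close>; but for \<open>t \<le> s\<close> both minima equal
    \<open>t\<close> and the increment vanishes.\<close>
  proof (cases "t \<le> s")
    case True
    with step show ?thesis by (simp add: min_def)
  next
    case False
    have "S (min t v) \<in> borel_measurable (F t)" if "0 \<le> v" "v \<le> T" for v
      using filtration_measurable_mono[OF assms(2), of "min t v" t "S (min t v)"] assms(3) t that
      by (auto simp: adapted_cadlag_def)
    moreover have "h \<in> borel_measurable (F t)"
      using filtration_measurable_mono[OF assms(2), of s t h] step t False by auto
    ultimately show ?thesis
      using step by (intro borel_measurable_inner borel_measurable_diff) auto
  qed
  moreover have "cadlag_on T (\<lambda>t. h \<omega> \<bullet> (S (min t u) \<omega> - S (min t s) \<omega>))"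
    if "\<omega> \<in> space P" for \<omega>
  proof -
    have "cadlag_on T (\<lambda>t. S (min t v) \<omega>)" for v
      using assms(3) that by (auto simp: adapted_cadlag_def intro: cadlag_on_min)
    then have "cadlag_on T (\<lambda>t. S (min t u) \<omega> + - S (min t s) \<omega>)"
      by (intro cadlag_on_add cadlag_on_compose[where g = uminus]) auto
    then have "cadlag_on T (\<lambda>t. S (min t u) \<omega> - S (min t s) \<omega>)"
      by simp
    then show ?thesis
      by (rule cadlag_on_compose[where g = "\<lambda>x. h \<omega> \<bullet> x"]) (intro continuous_intros)
  qed
  ultimately show ?case
    by (simp add: adapted_cadlag_def)
next
  case (add H X G Y)
  then show ?case by (intro adapted_cadlag_add)
qed

lemma elementary_integral_bounded:
  assumes "elementary_integral P F T S H X"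
  shows "\<exists>c. \<forall>t. \<forall>\<omega>\<in>space P. norm (H t \<omega>) \<le> c"
  using assms
proof induction
  case (at_zero h c)
  then have "\<forall>t. \<forall>\<omega>\<in>space P. norm (if t = 0 then h \<omega> else 0) \<le> max c 0"
    by (auto intro: max.coboundedI1)
  then show ?case by blast
next
  case (step s u h c)
  then have "\<forall>t. \<forall>\<omega>\<in>space P. norm (if s < t \<and> t \<le> u then h \<omega> else 0) \<le> max c 0"
    by (auto intro: max.coboundedI1)
  then show ?case by blast
next
  case (add H X G Y)
  then show ?case
    by (meson add_mono norm_triangle_le)
qed

lemma elementary_integral_scale:
  assumes "elementary_integral P F T S H X"
  shows "elementary_integral P F T S (\<lambda>t \<omega>. a *\<^sub>R H t \<omega>) (\<lambda>t \<omega>. a * X t \<omega>)"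
  using assms
proof induction
  case (at_zero h c)
  have "elementary_integral P F T S (\<lambda>t \<omega>. if t = 0 then a *\<^sub>R h \<omega> else 0) (\<lambda>t \<omega>. 0)"
    by (rule elementary_integral.at_zero[where c = "\<bar>a\<bar> * c"])
      (use at_zero in \<open>auto intro: mult_left_mono\<close>)
  then show ?case by (simp add: if_distrib cong: if_cong)
next
  case (step s u h c)
  have "elementary_integral P F T S (\<lambda>t \<omega>. if s < t \<and> t \<le> u then a *\<^sub>R h \<omega> else 0)
      (\<lambda>t \<omega>. (a *\<^sub>R h \<omega>) \<bullet> (S (min t u) \<omega> - S (min t s) \<omega>))"
    by (rule elementary_integral.step[where c = "\<bar>a\<bar> * c"])
      (use step in \<open>auto intro: mult_left_mono\<close>)
  then show ?case by (simp add: if_distrib cong: if_cong)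
next
  case (add H X G Y)
  then show ?case
    using elementary_integral.add[OF add.IH] by (simp add: algebra_simps)
qed

text \<open>Every generating rule is linear in the integrator, so the same \<open>K\<close> can be
  integrated against \<open>X\<close> and \<open>Y\<close> separately. Emery convergence tests
  differences of integrators, and this splits the test integral of a sum.\<close>

lemma elementary_integral_integrator_add:
  assumes "elementary_integral P F T (\<lambda>t \<omega>. X t \<omega> + Y t \<omega>) K Z"
  shows "\<exists>Z1 Z2. elementary_integral P F T X K Z1 \<and> elementary_integral P F T Y K Z2 \<and>
           Z = (\<lambda>t \<omega>. Z1 t \<omega> + Z2 t \<omega>)"
  using assms
proof induction
  case (at_zero h c)
  have "(\<lambda>(t::real) (\<omega>::'a). 0::real) = (\<lambda>t \<omega>. 0 + 0)"
    by simp
  with elementary_integral.at_zero[where F = F and P = P and h = h and c = c, OF at_zero] show ?case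
    by blast
next
  case (step s u h c)
  have "(\<lambda>t \<omega>. h \<omega> \<bullet> (X (min t u) \<omega> + Y (min t u) \<omega> - (X (min t s) \<omega> + Y (min t s) \<omega>))) =
      (\<lambda>t \<omega>. h \<omega> \<bullet> (X (min t u) \<omega> - X (min t s) \<omega>) + h \<omega> \<bullet> (Y (min t u) \<omega> - Y (min t s) \<omega>))"
    by (simp add: fun_eq_iff inner_diff_right inner_add_right)
  with elementary_integral.step[where F = F and P = P and h = h and c = c, OF step] show ?case
    by blast
next
  case (add H X' G Y')
  then obtain A1 A2 B1 B2 where
    "elementary_integral P F T X H A1" "elementary_integral P F T Y H A2"
    "X' = (\<lambda>t \<omega>. A1 t \<omega> + A2 t \<omega>)"
    "elementary_integral P F T X G B1" "elementary_integral P F T Y G B2"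
    "Y' = (\<lambda>t \<omega>. B1 t \<omega> + B2 t \<omega>)"
    by blast
  moreover from this have "(\<lambda>t \<omega>. X' t \<omega> + Y' t \<omega>) =
      (\<lambda>t \<omega>. (A1 t \<omega> + B1 t \<omega>) + (A2 t \<omega> + B2 t \<omega>))"
    by (simp add: fun_eq_iff)
  ultimately show ?case
    by (blast intro: elementary_integral.add)
qed

text \<open>Also used with \<open>a = 0\<close>, where it shows that every elementary integral
  against the zero process vanishes.\<close>

lemma elementary_integral_integrator_scale:
  fixes X :: "real \<Rightarrow> 'a \<Rightarrow> real"
  assumes "elementary_integral P F T (\<lambda>t \<omega>. a * X t \<omega>) K Z"
  shows "\<exists>Z'. elementary_integral P F T X K Z' \<and> Z = (\<lambda>t \<omega>. a * Z' t \<omega>)"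
  using assms
proof induction
  case (at_zero h c)
  have "(\<lambda>(t::real) (\<omega>::'a). 0) = (\<lambda>t \<omega>. a * 0)"
    by simp
  with elementary_integral.at_zero[where F = F and P = P and h = h and c = c, OF at_zero] show ?case
    by blast
next
  case (step s u h c)
  have "(\<lambda>t \<omega>. h \<omega> \<bullet> (a * X (min t u) \<omega> - a * X (min t s) \<omega>)) =
      (\<lambda>t \<omega>. a * (h \<omega> \<bullet> (X (min t u) \<omega> - X (min t s) \<omega>)))"
    by (simp add: fun_eq_iff algebra_simps)
  with elementary_integral.step[where F = F and P = P and h = h and c = c, OF step] show ?case
    by blast
next
  case (add H X' G Y')
  then obtain A B where
    "elementary_integral P F T X H A" "X' = (\<lambda>t \<omega>. a * A t \<omega>)"
    "elementary_integral P F T X G B" "Y' = (\<lambda>t \<omega>. a * B t \<omega>)"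
    by blast
  moreover from this have "(\<lambda>t \<omega>. X' t \<omega> + Y' t \<omega>) = (\<lambda>t \<omega>. a * (A t \<omega> + B t \<omega>))"
    by (simp add: fun_eq_iff algebra_simps)
  ultimately show ?case
    by (blast intro: elementary_integral.add)
qed

section \<open>Linearity of the integral of bounded integrands\<close>

text \<open>The limit rule itself requires its limit to be adapted and cadlag, so case analysis
  replaces induction.\<close>

lemma bounded_integral_adapted_cadlag:
  assumes "bounded_integral P F T S H X" "usual_conditions P F T" "adapted_cadlag P F T S"
  shows "adapted_cadlag P F T X"
  using assms(1)
  by cases (use assms elementary_integral_adapted_cadlag in blast)+

lemma bounded_integral_bounded:
  assumes "bounded_integral P F T S H X"
  shows "\<exists>c. \<forall>t\<in>{0..T}. \<forall>\<omega>\<in>space P. norm (H t \<omega>) \<le> c"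
  using assms
proof cases
  case elementary
  then show ?thesis
    using elementary_integral_bounded by blast
next
  case (limit Hn Xn c)
  have "norm (H t \<omega>) \<le> c" if "t \<in> {0..T}" "\<omega> \<in> space P" for t \<omega>
    by (rule Lim_bounded[OF tendsto_norm, of "\<lambda>n. Hn n t \<omega>" _ 0]) (use that limit in auto)
  then show ?thesis by blast
qed

text \<open>Sums are treated by induction on one summand with the other fixed: here \<open>H\<close>
  varies and \<open>G\<close> is elementary; in \<open>bounded_integral_add\<close>,
  \<open>G\<close> varies and \<open>H\<close> is any bounded integrand. A fixed summand cancels
  from the ucp difference.\<close>

lemma bounded_integral_add_elementary:
  assumes "bounded_integral P F T S H X" "elementary_integral P F T S G Y"
    and "usual_conditions P F T" "adapted_cadlag P F T S"
  shows "bounded_integral P F T S (\<lambda>t \<omega>. H t \<omega> + G t \<omega>) (\<lambda>t \<omega>. X t \<omega> + Y t \<omega>)"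
  using assms(1)
proof induction
  case (elementary H X)
  then show ?case
    using assms by (intro bounded_integral.elementary elementary_integral.add)
next
  case (limit H X c H' X')
  obtain d where d: "\<And>t \<omega>. \<omega> \<in> space P \<Longrightarrow> norm (G t \<omega>) \<le> d"
    using elementary_integral_bounded[OF assms(2)] by blast
  show ?case
  proof (rule bounded_integral.limit[where c = "c + d"])
    show "bounded_integral P F T S (\<lambda>t \<omega>. H n t \<omega> + G t \<omega>) (\<lambda>t \<omega>. X n t \<omega> + Y t \<omega>)" for n
      by (rule limit.IH)
    show "\<forall>n. \<forall>t\<in>{0..T}. \<forall>\<omega>\<in>space P. norm (H n t \<omega> + G t \<omega>) \<le> c + d"
      using limit d by (blast intro: norm_triangle_le add_mono)
    show "\<forall>t\<in>{0..T}. \<forall>\<omega>\<in>space P. (\<lambda>n. H n t \<omega> + G t \<omega>) \<longlonglongrightarrow> H' t \<omega> + G t \<omega>"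
      using limit by (auto intro: tendsto_add)
    show "adapted_cadlag P F T (\<lambda>t \<omega>. X' t \<omega> + Y t \<omega>)"
      using limit elementary_integral_adapted_cadlag[OF assms(2-4)] by (intro adapted_cadlag_add)
    show "ucp_tendsto P T (\<lambda>n t \<omega>. X n t \<omega> + Y t \<omega>) (\<lambda>t \<omega>. X' t \<omega> + Y t \<omega>)"
      using limit by (simp add: ucp_tendsto_def)
  qed
qed

lemma bounded_integral_add:
  assumes "bounded_integral P F T S H X" "bounded_integral P F T S G Y"
    and "usual_conditions P F T" "adapted_cadlag P F T S"
  shows "bounded_integral P F T S (\<lambda>t \<omega>. H t \<omega> + G t \<omega>) (\<lambda>t \<omega>. X t \<omega> + Y t \<omega>)"
  using assms(2)
proof induction
  case (elementary G Y)
  then show ?case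
    using assms by (intro bounded_integral_add_elementary)
next
  case (limit G Y c G' Y')
  obtain d where d: "\<And>t \<omega>. t \<in> {0..T} \<Longrightarrow> \<omega> \<in> space P \<Longrightarrow> norm (H t \<omega>) \<le> d"
    using bounded_integral_bounded[OF assms(1)] by blast
  show ?case
  proof (rule bounded_integral.limit[where c = "d + c"])
    show "bounded_integral P F T S (\<lambda>t \<omega>. H t \<omega> + G n t \<omega>) (\<lambda>t \<omega>. X t \<omega> + Y n t \<omega>)" for n
      by (rule limit.IH)
    show "\<forall>n. \<forall>t\<in>{0..T}. \<forall>\<omega>\<in>space P. norm (H t \<omega> + G n t \<omega>) \<le> d + c"
      using limit d by (blast intro: norm_triangle_le add_mono)
    show "\<forall>t\<in>{0..T}. \<forall>\<omega>\<in>space P. (\<lambda>n. H t \<omega> + G n t \<omega>) \<longlonglongrightarrow> H t \<omega> + G' t \<omega>"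
      using limit by (auto intro: tendsto_add)
    show "adapted_cadlag P F T (\<lambda>t \<omega>. X t \<omega> + Y' t \<omega>)"
      using limit bounded_integral_adapted_cadlag[OF assms(1,3,4)] by (intro adapted_cadlag_add)
    show "ucp_tendsto P T (\<lambda>n t \<omega>. X t \<omega> + Y n t \<omega>) (\<lambda>t \<omega>. X t \<omega> + Y' t \<omega>)"
      using limit by (simp add: ucp_tendsto_def)
  qed
qed

lemma bounded_integral_scale:
  assumes "bounded_integral P F T S H X"
  shows "bounded_integral P F T S (\<lambda>t \<omega>. a *\<^sub>R H t \<omega>) (\<lambda>t \<omega>. a * X t \<omega>)"
  using assms
proof induction
  case (elementary H X)
  then show ?case
    by (intro bounded_integral.elementary elementary_integral_scale)
next
  case (limit H X c H' X')
  show ?case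
  proof (rule bounded_integral.limit[where c = "\<bar>a\<bar> * c"])
    show "bounded_integral P F T S (\<lambda>t \<omega>. a *\<^sub>R H n t \<omega>) (\<lambda>t \<omega>. a * X n t \<omega>)" for n
      by (rule limit.IH)
    show "\<forall>n. \<forall>t\<in>{0..T}. \<forall>\<omega>\<in>space P. norm (a *\<^sub>R H n t \<omega>) \<le> \<bar>a\<bar> * c"
      using limit by (auto intro: mult_left_mono)
    show "\<forall>t\<in>{0..T}. \<forall>\<omega>\<in>space P. (\<lambda>n. a *\<^sub>R H n t \<omega>) \<longlonglongrightarrow> a *\<^sub>R H' t \<omega>"
      using limit by (auto intro: tendsto_scaleR)
    show "adapted_cadlag P F T (\<lambda>t \<omega>. a * X' t \<omega>)"
      using limit(4) by (rule adapted_cadlag_compose[where g = "\<lambda>x. a * x"]) (intro continuous_intros)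
    show "ucp_tendsto P T (\<lambda>n t \<omega>. a * X n t \<omega>) (\<lambda>t \<omega>. a * X' t \<omega>)"
      unfolding ucp_tendsto_def
    proof (intro allI impI)
      fix e :: real assume "0 < e"
      show "(\<lambda>n. measure P {\<omega>\<in>space P. \<exists>t\<in>{0..T}. e < \<bar>a * X n t \<omega> - a * X' t \<omega>\<bar>}) \<longlonglongrightarrow> 0"
      proof (cases "a = 0")
        case True
        with \<open>0 < e\<close> show ?thesis by simp
      next
        case False
        \<comment> \<open>Scaling by \<open>a \<noteq> 0\<close> only rescales the threshold, which
          is arbitrary in ucp convergence.\<close>
        have "e < \<bar>a * x - a * y\<bar> \<longleftrightarrow> e / \<bar>a\<bar> < \<bar>x - y\<bar>" for x y
          using False by (simp add: right_diff_distrib[symmetric] abs_mult pos_divide_less_eq mult.commute)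
        moreover have "e / \<bar>a\<bar> > 0" using \<open>0 < e\<close> False by simp
        ultimately show ?thesis
          using limit by (simp add: ucp_tendsto_def)
      qed
    qed
  qed
qed

section \<open>Emery convergence and general integrands\<close>

lemma elementary_integral_exceeds_sets:
  assumes "usual_conditions P F T" "0 \<le> T" "adapted_cadlag P F T D"
    and "elementary_integral P F T D K Z"
  shows "{\<omega>\<in>space P. \<exists>t\<in>{0..T}. (e::real) < \<bar>D 0 \<omega>\<bar> + \<bar>Z t \<omega>\<bar>} \<in> sets P"
proof -
  have "D 0 \<in> borel_measurable (F 0)"
    using assms by (auto simp: adapted_cadlag_def)
  then have "adapted_cadlag P F T (\<lambda>t \<omega>. \<bar>D 0 \<omega>\<bar>)"
    using assms(1) by (intro adapted_cadlag_const) auto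
  moreover have "adapted_cadlag P F T (\<lambda>t \<omega>. \<bar>Z t \<omega>\<bar>)"
    using elementary_integral_adapted_cadlag[OF assms(4,1,3)]
    by (rule adapted_cadlag_compose[where g = abs]) (rule continuous_rabs[OF continuous_ident])
  ultimately show ?thesis
    using adapted_cadlag_exceeds_sets[OF assms(1,2) adapted_cadlag_add] by blast
qed

text \<open>A test integrand \<open>K\<close> for the sum is, after splitting the integral along the
  integrator, a test integrand for both summands. Halving \<open>e\<close> serves twice: for the
  threshold, since one of two terms adding up to more than \<open>e\<close> exceeds
  \<open>e / 2\<close>, and for the probabilities in the union bound.\<close>

lemma emery_tendsto_add:
  assumes U: "usual_conditions P F T" "0 \<le> T"
    and X: "\<And>n. adapted_cadlag P F T (X n)" "adapted_cadlag P F T X'" "emery_tendsto P F T X X'"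
    and Y: "\<And>n. adapted_cadlag P F T (Y n)" "adapted_cadlag P F T Y'" "emery_tendsto P F T Y Y'"
  shows "emery_tendsto P F T (\<lambda>n t \<omega>. X n t \<omega> + Y n t \<omega>) (\<lambda>t \<omega>. X' t \<omega> + Y' t \<omega>)"
  unfolding emery_tendsto_def
proof (intro allI impI)
  interpret prob_space P using U by (simp add: usual_conditions_def)
  fix e :: real assume "0 < e"
  then have e: "0 < e / 2" by simp
  have "\<forall>\<^sub>F n in sequentially. \<forall>K Z.
      elementary_integral P F T (\<lambda>t \<omega>. X n t \<omega> - X' t \<omega>) K Z \<longrightarrow>
      (\<forall>t\<in>{0..T}. \<forall>\<omega>\<in>space P. \<bar>K t \<omega>\<bar> \<le> 1) \<longrightarrow>
      measure P {\<omega>\<in>space P. \<exists>t\<in>{0..T}. e / 2 < \<bar>X n 0 \<omega> - X' 0 \<omega>\<bar> + \<bar>Z t \<omega>\<bar>} < e / 2"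
    using X(3) e unfolding emery_tendsto_def by blast
  moreover have "\<forall>\<^sub>F n in sequentially. \<forall>K Z.
      elementary_integral P F T (\<lambda>t \<omega>. Y n t \<omega> - Y' t \<omega>) K Z \<longrightarrow>
      (\<forall>t\<in>{0..T}. \<forall>\<omega>\<in>space P. \<bar>K t \<omega>\<bar> \<le> 1) \<longrightarrow>
      measure P {\<omega>\<in>space P. \<exists>t\<in>{0..T}. e / 2 < \<bar>Y n 0 \<omega> - Y' 0 \<omega>\<bar> + \<bar>Z t \<omega>\<bar>} < e / 2"
    using Y(3) e unfolding emery_tendsto_def by blast
  ultimately show "\<forall>\<^sub>F n in sequentially. \<forall>K Z.
      elementary_integral P F T (\<lambda>t \<omega>. X n t \<omega> + Y n t \<omega> - (X' t \<omega> + Y' t \<omega>)) K Z \<longrightarrow>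
      (\<forall>t\<in>{0..T}. \<forall>\<omega>\<in>space P. \<bar>K t \<omega>\<bar> \<le> 1) \<longrightarrow>
      measure P {\<omega>\<in>space P. \<exists>t\<in>{0..T}.
        e < \<bar>X n 0 \<omega> + Y n 0 \<omega> - (X' 0 \<omega> + Y' 0 \<omega>)\<bar> + \<bar>Z t \<omega>\<bar>} < e"
  proof (eventually_elim, intro allI impI)
    fix n K Z
    let ?X = "\<lambda>t \<omega>. X n t \<omega> - X' t \<omega>" and ?Y = "\<lambda>t \<omega>. Y n t \<omega> - Y' t \<omega>"
    let ?A = "\<lambda>D Z. {\<omega>\<in>space P. \<exists>t\<in>{0..T}. e / 2 < \<bar>D 0 \<omega>\<bar> + \<bar>Z t \<omega>\<bar>}"
    assume Xn: "\<forall>K Z. elementary_integral P F T ?X K Z \<longrightarrow>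
        (\<forall>t\<in>{0..T}. \<forall>\<omega>\<in>space P. \<bar>K t \<omega>\<bar> \<le> 1) \<longrightarrow> measure P (?A ?X Z) < e / 2"
      and Yn: "\<forall>K Z. elementary_integral P F T ?Y K Z \<longrightarrow>
        (\<forall>t\<in>{0..T}. \<forall>\<omega>\<in>space P. \<bar>K t \<omega>\<bar> \<le> 1) \<longrightarrow> measure P (?A ?Y Z) < e / 2"
      and Z: "elementary_integral P F T (\<lambda>t \<omega>. X n t \<omega> + Y n t \<omega> - (X' t \<omega> + Y' t \<omega>)) K Z"
      and K: "\<forall>t\<in>{0..T}. \<forall>\<omega>\<in>space P. \<bar>K t \<omega>\<bar> \<le> 1"
    from Z have "elementary_integral P F T (\<lambda>t \<omega>. ?X t \<omega> + ?Y t \<omega>) K Z"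
      by (simp add: algebra_simps)
    then obtain Z1 Z2 where Z1: "elementary_integral P F T ?X K Z1"
      and Z2: "elementary_integral P F T ?Y K Z2" and Z: "Z = (\<lambda>t \<omega>. Z1 t \<omega> + Z2 t \<omega>)"
      using elementary_integral_integrator_add[where X = ?X and Y = ?Y] by blast
    have sets: "?A ?X Z1 \<in> sets P" "?A ?Y Z2 \<in> sets P"
      using elementary_integral_exceeds_sets[OF U adapted_cadlag_minus[OF X(1,2)] Z1, of "e / 2"]
        elementary_integral_exceeds_sets[OF U adapted_cadlag_minus[OF Y(1,2)] Z2, of "e / 2"]
      by simp_all
    have "measure P {\<omega>\<in>space P. \<exists>t\<in>{0..T}.
        e < \<bar>X n 0 \<omega> + Y n 0 \<omega> - (X' 0 \<omega> + Y' 0 \<omega>)\<bar> + \<bar>Z t \<omega>\<bar>} \<le> measure P (?A ?X Z1 \<union> ?A ?Y Z2)"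
    proof (rule finite_measure_mono)
      show "{\<omega>\<in>space P. \<exists>t\<in>{0..T}.
        e < \<bar>X n 0 \<omega> + Y n 0 \<omega> - (X' 0 \<omega> + Y' 0 \<omega>)\<bar> + \<bar>Z t \<omega>\<bar>} \<subseteq> ?A ?X Z1 \<union> ?A ?Y Z2"
      proof
        fix \<omega> assume "\<omega> \<in> {\<omega>\<in>space P. \<exists>t\<in>{0..T}.
          e < \<bar>X n 0 \<omega> + Y n 0 \<omega> - (X' 0 \<omega> + Y' 0 \<omega>)\<bar> + \<bar>Z t \<omega>\<bar>}"
        then obtain t where t: "\<omega> \<in> space P" "t \<in> {0..T}"
          "e < \<bar>X n 0 \<omega> + Y n 0 \<omega> - (X' 0 \<omega> + Y' 0 \<omega>)\<bar> + \<bar>Z1 t \<omega> + Z2 t \<omega>\<bar>"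
          by (auto simp: Z)
        then have "e / 2 < \<bar>?X 0 \<omega>\<bar> + \<bar>Z1 t \<omega>\<bar> \<or> e / 2 < \<bar>?Y 0 \<omega>\<bar> + \<bar>Z2 t \<omega>\<bar>"
          by linarith
        with t show "\<omega> \<in> ?A ?X Z1 \<union> ?A ?Y Z2" by auto
      qed
    qed (use sets in auto)
    also have "\<dots> \<le> measure P (?A ?X Z1) + measure P (?A ?Y Z2)"
      using sets by (rule measure_Un_le)
    also have "\<dots> < e / 2 + e / 2"
      using Xn Yn Z1 Z2 K by (intro add_strict_mono) blast+
    finally show "measure P {\<omega>\<in>space P. \<exists>t\<in>{0..T}.
        e < \<bar>X n 0 \<omega> + Y n 0 \<omega> - (X' 0 \<omega> + Y' 0 \<omega>)\<bar> + \<bar>Z t \<omega>\<bar>} < e"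
      by simp
  qed
qed

lemma emery_tendsto_scale:
  assumes U: "usual_conditions P F T" "0 \<le> T"
    and X: "\<And>n. adapted_cadlag P F T (X n)" "adapted_cadlag P F T X'" "emery_tendsto P F T X X'"
  shows "emery_tendsto P F T (\<lambda>n t \<omega>. a * X n t \<omega>) (\<lambda>t \<omega>. a * X' t \<omega>)"
  unfolding emery_tendsto_def
proof (intro allI impI)
  interpret prob_space P using U by (simp add: usual_conditions_def)
  fix e :: real assume "0 < e"
  \<comment> \<open>One number bounds both threshold and probability:
    \<open>\<bar>a\<bar> * d \<le> e\<close> serves the former, \<open>d \<le> e\<close> the latter,
    and the added 1 covers \<open>a = 0\<close>.\<close>
  define d where "d = e / (\<bar>a\<bar> + 1)"
  have d: "0 < d" "d \<le> e" "\<bar>a\<bar> * d \<le> e"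
    using \<open>0 < e\<close> by (auto simp: d_def field_simps)
  have "\<forall>\<^sub>F n in sequentially. \<forall>K Z.
      elementary_integral P F T (\<lambda>t \<omega>. X n t \<omega> - X' t \<omega>) K Z \<longrightarrow>
      (\<forall>t\<in>{0..T}. \<forall>\<omega>\<in>space P. \<bar>K t \<omega>\<bar> \<le> 1) \<longrightarrow>
      measure P {\<omega>\<in>space P. \<exists>t\<in>{0..T}. d < \<bar>X n 0 \<omega> - X' 0 \<omega>\<bar> + \<bar>Z t \<omega>\<bar>} < d"
    using X(3) d unfolding emery_tendsto_def by blast
  then show "\<forall>\<^sub>F n in sequentially. \<forall>K Z.
      elementary_integral P F T (\<lambda>t \<omega>. a * X n t \<omega> - a * X' t \<omega>) K Z \<longrightarrow>
      (\<forall>t\<in>{0..T}. \<forall>\<omega>\<in>space P. \<bar>K t \<omega>\<bar> \<le> 1) \<longrightarrow>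
      measure P {\<omega>\<in>space P. \<exists>t\<in>{0..T}. e < \<bar>a * X n 0 \<omega> - a * X' 0 \<omega>\<bar> + \<bar>Z t \<omega>\<bar>} < e"
  proof (eventually_elim, intro allI impI)
    fix n K Z
    let ?X = "\<lambda>t \<omega>. X n t \<omega> - X' t \<omega>"
    let ?A = "\<lambda>Z. {\<omega>\<in>space P. \<exists>t\<in>{0..T}. d < \<bar>X n 0 \<omega> - X' 0 \<omega>\<bar> + \<bar>Z t \<omega>\<bar>}"
    assume Xn: "\<forall>K Z. elementary_integral P F T ?X K Z \<longrightarrow>
        (\<forall>t\<in>{0..T}. \<forall>\<omega>\<in>space P. \<bar>K t \<omega>\<bar> \<le> 1) \<longrightarrow> measure P (?A Z) < d"
      and Z: "elementary_integral P F T (\<lambda>t \<omega>. a * X n t \<omega> - a * X' t \<omega>) K Z"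
      and K: "\<forall>t\<in>{0..T}. \<forall>\<omega>\<in>space P. \<bar>K t \<omega>\<bar> \<le> 1"
    from Z have "elementary_integral P F T (\<lambda>t \<omega>. a * ?X t \<omega>) K Z"
      by (simp add: algebra_simps)
    then obtain Z' where Z': "elementary_integral P F T ?X K Z'" and Z: "Z = (\<lambda>t \<omega>. a * Z' t \<omega>)"
      using elementary_integral_integrator_scale[where X = ?X] by blast
    have "measure P {\<omega>\<in>space P. \<exists>t\<in>{0..T}. e < \<bar>a * X n 0 \<omega> - a * X' 0 \<omega>\<bar> + \<bar>Z t \<omega>\<bar>}
        \<le> measure P (?A Z')"
    proof (rule finite_measure_mono)
      show "{\<omega>\<in>space P. \<exists>t\<in>{0..T}. e < \<bar>a * X n 0 \<omega> - a * X' 0 \<omega>\<bar> + \<bar>Z t \<omega>\<bar>} \<subseteq> ?A Z'"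
      proof
        fix \<omega> assume "\<omega> \<in> {\<omega>\<in>space P. \<exists>t\<in>{0..T}. e < \<bar>a * X n 0 \<omega> - a * X' 0 \<omega>\<bar> + \<bar>Z t \<omega>\<bar>}"
        then obtain t where t: "\<omega> \<in> space P" "t \<in> {0..T}"
          "e < \<bar>a * X n 0 \<omega> - a * X' 0 \<omega>\<bar> + \<bar>a * Z' t \<omega>\<bar>"
          by (auto simp: Z)
        then have "\<bar>a\<bar> * d < \<bar>a\<bar> * (\<bar>?X 0 \<omega>\<bar> + \<bar>Z' t \<omega>\<bar>)"
          using d(3) by (simp add: right_diff_distrib[symmetric] distrib_left abs_mult)
        \<comment> \<open>For \<open>a = 0\<close> the strict inequality would read
          \<open>0 < 0\<close>, so the factor can be cancelled.\<close>
        then have "d < \<bar>?X 0 \<omega>\<bar> + \<bar>Z' t \<omega>\<bar>"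
          by (simp add: mult_less_cancel_left)
        with t show "\<omega> \<in> ?A Z'" by auto
      qed
      show "?A Z' \<in> sets P"
        using elementary_integral_exceeds_sets[OF U adapted_cadlag_minus[OF X(1,2)] Z', of d] by simp
    qed
    also have "\<dots> < d"
      using Xn Z' K by blast
    finally show "measure P {\<omega>\<in>space P. \<exists>t\<in>{0..T}. e < \<bar>a * X n 0 \<omega> - a * X' 0 \<omega>\<bar> + \<bar>Z t \<omega>\<bar>} < e"
      using d by simp
  qed
qed

text \<open>The definition admits any approximating bounded integrands. This matters here:
  truncations of \<open>H + G\<close> need not be sums of truncations, but the sums of two
  approximating sequences do approximate.\<close>

lemma stochastic_integral_add:
  assumes U: "usual_conditions P F T" "0 \<le> T" and S: "adapted_cadlag P F T S"
    and H: "stochastic_integral P F T S H X" and G: "stochastic_integral P F T S G Y"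
  shows "stochastic_integral P F T S (\<lambda>t \<omega>. H t \<omega> + G t \<omega>) (\<lambda>t \<omega>. X t \<omega> + Y t \<omega>)"
proof -
  from H obtain Hn Xn where Hn: "\<And>n. bounded_integral P F T S (Hn n) (Xn n)"
    "\<And>t \<omega>. t \<in> {0..T} \<Longrightarrow> \<omega> \<in> space P \<Longrightarrow> (\<lambda>n. Hn n t \<omega>) \<longlonglongrightarrow> H t \<omega>" "emery_tendsto P F T Xn X"
    unfolding stochastic_integral_def by blast
  from G obtain Gn Yn where Gn: "\<And>n. bounded_integral P F T S (Gn n) (Yn n)"
    "\<And>t \<omega>. t \<in> {0..T} \<Longrightarrow> \<omega> \<in> space P \<Longrightarrow> (\<lambda>n. Gn n t \<omega>) \<longlonglongrightarrow> G t \<omega>" "emery_tendsto P F T Yn Y"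
    unfolding stochastic_integral_def by blast
  have c: "adapted_cadlag P F T X" "adapted_cadlag P F T Y"
    using H G by (auto simp: stochastic_integral_def)
  have "predictable P F T (\<lambda>t \<omega>. H t \<omega> + G t \<omega>)"
    using H G unfolding stochastic_integral_def predictable_def case_prod_beta
    by (intro borel_measurable_add) auto
  moreover have "\<forall>n. bounded_integral P F T S (\<lambda>t \<omega>. Hn n t \<omega> + Gn n t \<omega>) (\<lambda>t \<omega>. Xn n t \<omega> + Yn n t \<omega>)"
    using Hn Gn U S by (blast intro: bounded_integral_add)
  moreover have "\<forall>t\<in>{0..T}. \<forall>\<omega>\<in>space P. (\<lambda>n. Hn n t \<omega> + Gn n t \<omega>) \<longlonglongrightarrow> H t \<omega> + G t \<omega>"
    using Hn Gn by (auto intro: tendsto_add)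
  moreover have "emery_tendsto P F T (\<lambda>n t \<omega>. Xn n t \<omega> + Yn n t \<omega>) (\<lambda>t \<omega>. X t \<omega> + Y t \<omega>)"
    by (intro emery_tendsto_add[OF U] bounded_integral_adapted_cadlag[OF Hn(1) U(1) S]
        bounded_integral_adapted_cadlag[OF Gn(1) U(1) S] c Hn(3) Gn(3))
  ultimately show ?thesis
    unfolding stochastic_integral_def using adapted_cadlag_add[OF c]
    by (intro conjI exI[of _ "\<lambda>n t \<omega>. Hn n t \<omega> + Gn n t \<omega>"] exI[of _ "\<lambda>n t \<omega>. Xn n t \<omega> + Yn n t \<omega>"]) auto
qed

lemma stochastic_integral_scale:
  assumes U: "usual_conditions P F T" "0 \<le> T" and S: "adapted_cadlag P F T S"
    and H: "stochastic_integral P F T S H X"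
  shows "stochastic_integral P F T S (\<lambda>t \<omega>. a *\<^sub>R H t \<omega>) (\<lambda>t \<omega>. a * X t \<omega>)"
proof -
  from H obtain Hn Xn where Hn: "\<And>n. bounded_integral P F T S (Hn n) (Xn n)"
    "\<And>t \<omega>. t \<in> {0..T} \<Longrightarrow> \<omega> \<in> space P \<Longrightarrow> (\<lambda>n. Hn n t \<omega>) \<longlonglongrightarrow> H t \<omega>" "emery_tendsto P F T Xn X"
    unfolding stochastic_integral_def by blast
  have c: "adapted_cadlag P F T X"
    using H by (auto simp: stochastic_integral_def)
  have "predictable P F T (\<lambda>t \<omega>. a *\<^sub>R H t \<omega>)"
    using H unfolding stochastic_integral_def predictable_def case_prod_beta
    by (intro borel_measurable_scaleR) auto
  moreover have "\<forall>n. bounded_integral P F T S (\<lambda>t \<omega>. a *\<^sub>R Hn n t \<omega>) (\<lambda>t \<omega>. a * Xn n t \<omega>)"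
    using Hn by (blast intro: bounded_integral_scale)
  moreover have "\<forall>t\<in>{0..T}. \<forall>\<omega>\<in>space P. (\<lambda>n. a *\<^sub>R Hn n t \<omega>) \<longlonglongrightarrow> a *\<^sub>R H t \<omega>"
    using Hn by (auto intro: tendsto_scaleR)
  moreover have "emery_tendsto P F T (\<lambda>n t \<omega>. a * Xn n t \<omega>) (\<lambda>t \<omega>. a * X t \<omega>)"
    by (intro emery_tendsto_scale[OF U] bounded_integral_adapted_cadlag[OF Hn(1) U(1) S] c Hn(3))
  moreover have "adapted_cadlag P F T (\<lambda>t \<omega>. a * X t \<omega>)"
    using c by (rule adapted_cadlag_compose[where g = "\<lambda>x. a * x"]) (intro continuous_intros)
  ultimately show ?thesis
    unfolding stochastic_integral_def
    by (intro conjI exI[of _ "\<lambda>n t \<omega>. a *\<^sub>R Hn n t \<omega>"] exI[of _ "\<lambda>n t \<omega>. a * Xn n t \<omega>"]) auto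
qed

lemma stochastic_integral_zero:
  "stochastic_integral P F T S (\<lambda>t \<omega>. 0) (\<lambda>t \<omega>. 0)"
proof -
  have "elementary_integral P F T S (\<lambda>t \<omega>. if t = 0 then 0 else 0) (\<lambda>t \<omega>. 0)"
    by (rule elementary_integral.at_zero[where c = 0]) auto
  then have "bounded_integral P F T S (\<lambda>t \<omega>. 0) (\<lambda>t \<omega>. 0)"
    by (intro bounded_integral.elementary) simp
  moreover have "emery_tendsto P F T (\<lambda>n t \<omega>. 0) (\<lambda>t \<omega>. 0)"
    unfolding emery_tendsto_def
  proof (intro allI impI always_eventually)
    fix e :: real and K Z :: "real \<Rightarrow> 'a \<Rightarrow> real"
    assume e: "0 < e" and "elementary_integral P F T (\<lambda>t \<omega>. 0 - 0) K Z"
    \<comment> \<open>The zero integrator is written as a multiple by 0, so that scaling in the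
      integrator forces \<open>Z\<close> to vanish.\<close>
    then have "elementary_integral P F T (\<lambda>t \<omega>. 0 * 0) K Z" by simp
    then obtain Z' where "Z = (\<lambda>t \<omega>. 0 * Z' t \<omega>)"
      using elementary_integral_integrator_scale[where a = 0 and X = "\<lambda>t \<omega>. 0"] by blast
    with e show "measure P {\<omega> \<in> space P. \<exists>t\<in>{0..T}. e < \<bar>0 - 0\<bar> + \<bar>Z t \<omega>\<bar>} < e"
      by simp
  qed
  ultimately show ?thesis
    unfolding stochastic_integral_def
    by (auto simp: predictable_def adapted_cadlag_def
        intro!: exI[of _ "\<lambda>n t \<omega>. 0"])
qed

section \<open>The cone of attainable claims\<close>

lemma K_adm_zero:
  assumes "0 \<le> T"
  shows "(\<lambda>\<omega>. 0) \<in> K_adm P F T S"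
  using stochastic_integral_zero[of P F T S]
  by (force simp: K_adm_def L0_def admissible_integral_def)

lemma K_adm_add:
  assumes U: "usual_conditions P F T" "0 \<le> T" and S: "adapted_cadlag P F T S"
    and Z: "Z \<in> K_adm P F T S" "Z' \<in> K_adm P F T S"
  shows "(\<lambda>\<omega>. Z \<omega> + Z' \<omega>) \<in> K_adm P F T S"
proof -
  obtain H X c where H: "stochastic_integral P F T S H X" "0 \<le> c"
    "\<And>t. t \<in> {0..T} \<Longrightarrow> AE \<omega> in P. X t \<omega> \<ge> - c" "AE \<omega> in P. Z \<omega> = X T \<omega>"
    using Z(1) by (auto simp: K_adm_def admissible_integral_def)
  obtain G Y d where G: "stochastic_integral P F T S G Y" "0 \<le> d"
    "\<And>t. t \<in> {0..T} \<Longrightarrow> AE \<omega> in P. Y t \<omega> \<ge> - d" "AE \<omega> in P. Z' \<omega> = Y T \<omega>"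
    using Z(2) by (auto simp: K_adm_def admissible_integral_def)
  have "AE \<omega> in P. X t \<omega> + Y t \<omega> \<ge> - (c + d)" if "t \<in> {0..T}" for t
    using H(3)[OF that] G(3)[OF that] by eventually_elim auto
  then have "admissible_integral P F T S (\<lambda>t \<omega>. H t \<omega> + G t \<omega>) (\<lambda>t \<omega>. X t \<omega> + Y t \<omega>)"
    using stochastic_integral_add[OF U S H(1) G(1)] H(2) G(2)
    unfolding admissible_integral_def by (blast intro: add_nonneg_nonneg)
  moreover have "AE \<omega> in P. Z \<omega> + Z' \<omega> = X T \<omega> + Y T \<omega>"
    using H(4) G(4) by eventually_elim auto
  moreover have "(\<lambda>\<omega>. Z \<omega> + Z' \<omega>) \<in> L0 P"
    using Z by (auto simp: K_adm_def L0_def)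
  ultimately show ?thesis
    unfolding K_adm_def by blast
qed

lemma K_adm_scale:
  assumes U: "usual_conditions P F T" "0 \<le> T" and S: "adapted_cadlag P F T S"
    and Z: "Z \<in> K_adm P F T S" and a: "0 \<le> a"
  shows "(\<lambda>\<omega>. a * Z \<omega>) \<in> K_adm P F T S"
proof -
  obtain H X c where H: "stochastic_integral P F T S H X" "0 \<le> c"
    "\<And>t. t \<in> {0..T} \<Longrightarrow> AE \<omega> in P. X t \<omega> \<ge> - c" "AE \<omega> in P. Z \<omega> = X T \<omega>"
    using Z by (auto simp: K_adm_def admissible_integral_def)
  have "AE \<omega> in P. a * X t \<omega> \<ge> - (a * c)" if "t \<in> {0..T}" for t
    using H(3)[OF that]
  proof eventually_elim
    case (elim \<omega>)
    then show ?case using mult_left_mono[OF elim a] by simp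
  qed
  then have "admissible_integral P F T S (\<lambda>t \<omega>. a *\<^sub>R H t \<omega>) (\<lambda>t \<omega>. a * X t \<omega>)"
    using stochastic_integral_scale[OF U S H(1)] H(2) a
    unfolding admissible_integral_def by (blast intro: mult_nonneg_nonneg)
  moreover have "AE \<omega> in P. a * Z \<omega> = a * X T \<omega>"
    using H(4) by eventually_elim auto
  moreover have "(\<lambda>\<omega>. a * Z \<omega>) \<in> L0 P"
    using Z by (auto simp: K_adm_def L0_def)
  ultimately show ?thesis
    unfolding K_adm_def by blast
qed

text \<open>This is the admissibility bound at time \<open>T\<close>; because of it, truncating a
  claim from above alone makes it bounded.\<close>

lemma K_adm_bounded_below:
  assumes "Z \<in> K_adm P F T S" "0 \<le> T"
  shows "\<exists>c\<ge>0. AE \<omega> in P. - c \<le> Z \<omega>"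
proof -
  obtain H X c where X: "stochastic_integral P F T S H X" "0 \<le> c"
    "\<And>t. t \<in> {0..T} \<Longrightarrow> AE \<omega> in P. X t \<omega> \<ge> - c" "AE \<omega> in P. Z \<omega> = X T \<omega>"
    using assms unfolding K_adm_def admissible_integral_def by blast
  have "AE \<omega> in P. - c \<le> Z \<omega>"
    using X(3)[of T] X(4) assms(2) by auto
  with X(2) show ?thesis by blast
qed

section \<open>Hahn-Banach\<close>

text \<open>This vector space structure makes the integrable functions a subspace, so that
  Hahn-Banach applies to functions themselves rather than to classes modulo null sets.\<close>

instantiation "fun" :: (type, real_vector) real_vector
begin

definition "scaleR c f = (\<lambda>x. c *\<^sub>R f x)"

instance
  by standard (simp_all add: scaleR_fun_def fun_eq_iff scaleR_add_right scaleR_add_left)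

end

text \<open>Relative to a set \<open>V\<close> because the functional in view, the L1-distance from
  a cone, is meaningful only at integrable functions: the integral of a non-integrable function is 0
  by convention.\<close>

definition sublinear_on :: "'v::real_vector set \<Rightarrow> ('v \<Rightarrow> real) \<Rightarrow> bool" where
  "sublinear_on V p \<longleftrightarrow>
     (\<forall>x\<in>V. \<forall>y\<in>V. p (x + y) \<le> p x + p y) \<and> (\<forall>x\<in>V. \<forall>t\<ge>0. p (t *\<^sub>R x) = t * p x)"

text \<open>Only \<open>t > 0\<close> has to be checked, which lets later proofs divide by
  \<open>t\<close>; \<open>p 0 = 0\<close> covers \<open>t = 0\<close>.\<close>

lemma sublinear_onI:
  assumes "\<And>x y. x \<in> V \<Longrightarrow> y \<in> V \<Longrightarrow> p (x + y) \<le> p x + p y"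
    and "\<And>x t. x \<in> V \<Longrightarrow> t > 0 \<Longrightarrow> p (t *\<^sub>R x) = t * p x" and "p 0 = 0"
  shows "sublinear_on V p"
  using assms unfolding sublinear_on_def by (metis less_eq_real_def mult_zero_left scaleR_zero_left)

lemma sublinear_onD:
  assumes "sublinear_on V p"
  shows "x \<in> V \<Longrightarrow> y \<in> V \<Longrightarrow> p (x + y) \<le> p x + p y"
    and "x \<in> V \<Longrightarrow> t \<ge> 0 \<Longrightarrow> p (t *\<^sub>R x) = t * p x"
    and "x \<in> V \<Longrightarrow> p 0 = 0"
proof -
  show "x \<in> V \<Longrightarrow> p 0 = 0"
    using assms unfolding sublinear_on_def by (metis mult_zero_left order_refl scaleR_zero_left)
qed (use assms in \<open>auto simp: sublinear_on_def\<close>)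

lemma sublinear_on_uminus_le:
  assumes "sublinear_on V p" "subspace V" "x \<in> V"
  shows "- p (- x) \<le> p x"
  using sublinear_onD(1)[OF assms(1,3) subspace_neg[OF assms(2,3)]] sublinear_onD(3)[OF assms(1,3)]
  by simp

text \<open>Pushing a sublinear functional down along the ray through y makes it additive in the
  direction y; a minimal one is therefore linear.\<close>

lemma sublinear_on_push_down:
  assumes p: "sublinear_on V p" and V: "subspace V" and y: "y \<in> V"
  defines "q \<equiv> \<lambda>x. INF t\<in>{0..}. p (x + t *\<^sub>R y) - t * p y"
  shows "sublinear_on V q" and "\<And>x t. x \<in> V \<Longrightarrow> t \<ge> 0 \<Longrightarrow> q x \<le> p (x + t *\<^sub>R y) - t * p y"
proof -
  note Vi = subspace_add[OF V] subspace_scale[OF V] subspace_neg[OF V] subspace_0[OF V]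
  \<comment> \<open>An infimum of reals needs a lower bound. Writing \<open>t *\<^sub>R y\<close> as
    \<open>- x + (x + t *\<^sub>R y)\<close> and using subadditivity gives one independent of
    \<open>t\<close>.\<close>
  have lb: "- p (- x) \<le> p (x + t *\<^sub>R y) - t * p y" if "x \<in> V" "t \<ge> 0" for x t
  proof -
    have "t * p y = p (- x + (x + t *\<^sub>R y))"
      using sublinear_onD(2)[OF p y] that by simp
    also have "\<dots> \<le> p (- x) + p (x + t *\<^sub>R y)"
      using that y by (intro sublinear_onD(1)[OF p] Vi)
    finally show ?thesis by simp
  qed
  then have bdd: "bdd_below ((\<lambda>t. p (x + t *\<^sub>R y) - t * p y) ` {0..})" if "x \<in> V" for x
    using that by (intro bdd_belowI2[where m = "- p (- x)"]) auto
  show le: "q x \<le> p (x + t *\<^sub>R y) - t * p y" if "x \<in> V" "t \<ge> 0" for x t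
    unfolding q_def using that by (intro cINF_lower bdd) auto
  have ge: "c \<le> q x" if "x \<in> V" "\<And>t. t \<ge> 0 \<Longrightarrow> c \<le> p (x + t *\<^sub>R y) - t * p y" for x c
    unfolding q_def using that by (intro cINF_greatest) auto
  show "sublinear_on V q"
  proof (rule sublinear_onI)
    fix x x' assume x: "x \<in> V" "x' \<in> V"
    \<comment> \<open>Different parameters for the two summands combine at \<open>t + s\<close>; the
      infima over \<open>s\<close> and \<open>t\<close> are then taken one after the other.\<close>
    have *: "q (x + x') \<le> (p (x + t *\<^sub>R y) - t * p y) + (p (x' + s *\<^sub>R y) - s * p y)"
      if "t \<ge> 0" "s \<ge> 0" for t s
    proof -
      have "q (x + x') \<le> p (x + x' + (t + s) *\<^sub>R y) - (t + s) * p y"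
        using x that by (intro le Vi) auto
      also have "x + x' + (t + s) *\<^sub>R y = (x + t *\<^sub>R y) + (x' + s *\<^sub>R y)"
        by (simp add: scaleR_add_left)
      also have "p \<dots> \<le> p (x + t *\<^sub>R y) + p (x' + s *\<^sub>R y)"
        using x y by (intro sublinear_onD(1)[OF p] Vi)
      finally show ?thesis by (simp add: algebra_simps)
    qed
    have "q (x + x') - (p (x + t *\<^sub>R y) - t * p y) \<le> q x'" if "t \<ge> 0" for t
      using *[OF that] x by (intro ge) (auto simp: algebra_simps)
    then have "q (x + x') - q x' \<le> q x"
      using x by (intro ge) (auto simp: algebra_simps)
    then show "q (x + x') \<le> q x + q x'" by simp
  next
    fix x and s :: real assume x: "x \<in> V" and s: "s > 0"
    \<comment> \<open>Scaling the argument by \<open>s\<close> reparametrizes the ray by the factor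
      \<open>s\<close>, a bijection of the nonnegative parameters.\<close>
    have eq: "p (s *\<^sub>R x + (s * t) *\<^sub>R y) - (s * t) * p y = s * (p (x + t *\<^sub>R y) - t * p y)" for t
    proof -
      have "s *\<^sub>R x + (s * t) *\<^sub>R y = s *\<^sub>R (x + t *\<^sub>R y)"
        by (simp add: scaleR_add_right)
      then show ?thesis
        using sublinear_onD(2)[OF p, of "x + t *\<^sub>R y" s] x y s Vi by (simp add: algebra_simps)
    qed
    have "q (s *\<^sub>R x) / s \<le> q x"
    proof (rule ge[OF x])
      fix t :: real assume "t \<ge> 0"
      then show "q (s *\<^sub>R x) / s \<le> p (x + t *\<^sub>R y) - t * p y"
        using le[of "s *\<^sub>R x" "s * t"] eq[of t] x s Vi by (simp add: divide_le_eq mult.commute)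
    qed
    moreover have "s * q x \<le> q (s *\<^sub>R x)"
    proof (rule ge)
      fix t :: real assume "t \<ge> 0"
      then show "s * q x \<le> p (s *\<^sub>R x + t *\<^sub>R y) - t * p y"
        using le[of x "t / s"] eq[of "t / s"] x s by simp
    qed (use x Vi in auto)
    ultimately show "q (s *\<^sub>R x) = s * q x"
      using s by (simp add: divide_le_eq mult.commute)
  next
    have "p (0 + t *\<^sub>R y) - t * p y = 0" if "t \<ge> 0" for t
      using sublinear_onD(2)[OF p y that] by simp
    then show "q 0 = 0"
      unfolding q_def by simp
  qed
qed

text \<open>Zorn's lemma downwards: a nonempty chain of sublinear functionals below \<open>p\<close>
  has its pointwise infimum as a lower bound, finite on \<open>V\<close> because every member lies
  above \<open>- p (- x)\<close>.\<close>

lemma sublinear_on_minimal: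
  assumes p: "sublinear_on V p" and V: "subspace V"
  shows "\<exists>f. sublinear_on V f \<and> (\<forall>x\<in>V. f x \<le> p x) \<and>
    (\<forall>g. sublinear_on V g \<longrightarrow> (\<forall>x\<in>V. g x \<le> f x) \<longrightarrow> (\<forall>x\<in>V. g x = f x))"
proof -
  note Vi = subspace_add[OF V] subspace_scale[OF V] subspace_neg[OF V] subspace_0[OF V]
  \<comment> \<open>The functionals are total functions compared at every point; prescribing 0
    outside \<open>V\<close> makes that order depend on \<open>V\<close> alone.\<close>
  define A where "A = {q. sublinear_on V q \<and> (\<forall>x\<in>V. q x \<le> p x) \<and> (\<forall>x. x \<notin> V \<longrightarrow> q x = 0)}"
  \<comment> \<open>The order is reversed, so that the maximal element from Zorn's lemma is a
    minimal functional.\<close>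
  let ?P = "\<lambda>q r. (r :: 'a \<Rightarrow> real) \<le> q"
  let ?on_V = "\<lambda>g x. if x \<in> V then g x else (0::real)"
  have on_V: "sublinear_on V (?on_V g)" if "sublinear_on V g" for g
    using that Vi unfolding sublinear_on_def by auto
  have "\<exists>m\<in>A. \<forall>a\<in>A. ?P m a \<longrightarrow> a = m"
  proof (rule predicate_Zorn)
    show "partial_order_on A (relation_of ?P A)"
      by (rule partial_order_on_relation_ofI) auto
    fix C assume C: "C \<in> Chains (relation_of ?P A)"
    show "\<exists>u\<in>A. \<forall>a\<in>C. ?P a u"
    proof (cases "C = {}")
      case True
      have "?on_V p \<in> A" using on_V[OF p] by (auto simp: A_def)
      with True show ?thesis by blast
    next
      case False
      have CA: "C \<subseteq> A" using C by (auto simp: Chains_def relation_of_def)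
      have chain: "q \<le> r \<or> r \<le> q" if "q \<in> C" "r \<in> C" for q r
        using C that by (auto simp: Chains_def relation_of_def)
      define u where "u = (\<lambda>x. INF q\<in>C. q x)"
      have lb: "- p (- x) \<le> q x" if "x \<in> V" "q \<in> C" for x q
      proof -
        have "q (- x) \<le> p (- x)" "- q (- x) \<le> q x"
          using that CA V Vi by (auto simp: A_def intro: sublinear_on_uminus_le)
        then show ?thesis by simp
      qed
      have le: "u x \<le> q x" if "x \<in> V" "q \<in> C" for x q
        unfolding u_def using that lb by (intro cINF_lower bdd_belowI2[where m = "- p (- x)"]) auto
      have ge: "c \<le> u x" if "\<And>q. q \<in> C \<Longrightarrow> c \<le> q x" for x c
        unfolding u_def using that False by (intro cINF_greatest)
      have "sublinear_on V u"
      proof (rule sublinear_onI)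
        fix x y assume x: "x \<in> V" "y \<in> V"
        \<comment> \<open>Subadditivity of the infimum needs a single functional below both
          \<open>q\<close> and \<open>r\<close>; comparability in the chain supplies
          \<open>s\<close>.\<close>
        have *: "u (x + y) \<le> q x + r y" if "q \<in> C" "r \<in> C" for q r
        proof -
          obtain s where s: "s \<in> C" "s \<le> q" "s \<le> r"
            using chain[of q r] \<open>q \<in> C\<close> \<open>r \<in> C\<close> by auto
          have "u (x + y) \<le> s (x + y)" using x s Vi by (intro le) auto
          also have "\<dots> \<le> s x + s y" using s x CA by (intro sublinear_onD) (auto simp: A_def)
          also have "\<dots> \<le> q x + r y" using s by (auto simp: le_fun_def intro: add_mono)
          finally show ?thesis .
        qed
        have "u (x + y) - q x \<le> u y" if "q \<in> C" for q
          using *[OF that] by (intro ge) (auto simp: algebra_simps)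
        then have "u (x + y) - u y \<le> u x"
          by (intro ge) (auto simp: algebra_simps)
        then show "u (x + y) \<le> u x + u y" by simp
      next
        fix x and t :: real assume x: "x \<in> V" and t: "t > 0"
        have eq: "q (t *\<^sub>R x) = t * q x" if "q \<in> C" for q
          using that x t CA by (intro sublinear_onD) (auto simp: A_def)
        have "u (t *\<^sub>R x) / t \<le> u x"
          using le[of "t *\<^sub>R x"] eq x t Vi by (intro ge) (auto simp: divide_le_eq mult.commute)
        moreover have "t * u x \<le> u (t *\<^sub>R x)"
        proof (rule ge)
          fix q assume "q \<in> C"
          then show "t * u x \<le> q (t *\<^sub>R x)"
            using le[of x q] x t by (simp add: eq[OF \<open>q \<in> C\<close>])
        qed
        ultimately show "u (t *\<^sub>R x) = t * u x"
          using t by (simp add: divide_le_eq mult.commute)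
      next
        have "q 0 = 0" if "q \<in> C" for q
          using that CA Vi(4) sublinear_onD(3)[of V q] by (auto simp: A_def)
        then have "(\<lambda>q. q 0) ` C = {0}" using False by force
        then show "u 0 = 0" by (simp add: u_def)
      qed
      moreover have "\<forall>x\<in>V. u x \<le> p x"
        using False le CA unfolding A_def by (blast intro: order_trans)
      ultimately have "?on_V u \<in> A"
        using on_V by (auto simp: A_def)
      moreover have "?on_V u \<le> q" if "q \<in> C" for q
        using that le CA by (auto simp: le_fun_def A_def)
      ultimately show ?thesis by blast
    qed
  qed
  then obtain m where m: "m \<in> A" "\<And>a. a \<in> A \<Longrightarrow> a \<le> m \<Longrightarrow> a = m" by blast
  have "g x = m x" if g: "sublinear_on V g" "\<forall>x\<in>V. g x \<le> m x" and x: "x \<in> V" for g x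
  proof -
    have "?on_V g \<in> A"
      using g m(1) on_V[OF g(1)] by (auto simp: A_def intro: order_trans)
    moreover have "?on_V g \<le> m"
      using g m(1) by (auto simp: le_fun_def A_def)
    ultimately have "?on_V g = m" by (rule m(2))
    with x show ?thesis by (auto dest: fun_cong[where x = x])
  qed
  with m(1) show ?thesis by (auto simp: A_def)
qed

text \<open>Rather than extending a functional from the line through \<open>z\<close>, the
  dominating functional is first pushed down along \<open>z\<close>. The result \<open>q\<close>
  satisfies \<open>q (- z) \<le> - p z\<close>, so every linear functional below \<open>q\<close>
  and \<open>p\<close> takes the value \<open>p z\<close> at \<open>z\<close>; minimality below
  \<open>q\<close> supplies linearity.\<close>

lemma Hahn_Banach_sublinear:
  assumes p: "sublinear_on V p" and V: "subspace V" and z: "z \<in> V"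
  obtains f where "\<And>x y. x \<in> V \<Longrightarrow> y \<in> V \<Longrightarrow> f (x + y) = f x + f y"
    and "\<And>c x. x \<in> V \<Longrightarrow> f (c *\<^sub>R x) = c * f x"
    and "\<And>x. x \<in> V \<Longrightarrow> f x \<le> p x" and "f z = p z"
proof -
  note Vi = subspace_add[OF V] subspace_scale[OF V] subspace_neg[OF V] subspace_0[OF V]
  define q where "q = (\<lambda>x. INF t\<in>{0..}. p (x + t *\<^sub>R z) - t * p z)"
  have q: "sublinear_on V q" "\<And>x t. x \<in> V \<Longrightarrow> t \<ge> 0 \<Longrightarrow> q x \<le> p (x + t *\<^sub>R z) - t * p z"
    unfolding q_def using sublinear_on_push_down[OF p V z] by auto
  obtain f where f: "sublinear_on V f" "\<And>x. x \<in> V \<Longrightarrow> f x \<le> q x"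
    and min: "\<And>g x. sublinear_on V g \<Longrightarrow> \<forall>x\<in>V. g x \<le> f x \<Longrightarrow> x \<in> V \<Longrightarrow> g x = f x"
    using sublinear_on_minimal[OF q(1) V] by blast
  have add: "f (x + y) = f x + f y" if xy: "x \<in> V" "y \<in> V" for x y
  proof (rule antisym)
    show "f (x + y) \<le> f x + f y" using sublinear_onD(1)[OF f(1)] xy .
    \<comment> \<open>Pushing \<open>f\<close> down along \<open>y\<close> gives a sublinear
      functional below \<open>f\<close>, hence equal to \<open>f\<close> on \<open>V\<close>; its
      defining inequality at parameter 1 is superadditivity.\<close>
    define g where "g = (\<lambda>x. INF t\<in>{0..}. f (x + t *\<^sub>R y) - t * f y)"
    have g: "sublinear_on V g" "\<And>x t. x \<in> V \<Longrightarrow> t \<ge> 0 \<Longrightarrow> g x \<le> f (x + t *\<^sub>R y) - t * f y"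
      unfolding g_def using sublinear_on_push_down[OF f(1) V xy(2)] by auto
    have "g x = f x"
      using g(2)[of _ 0] xy by (intro min g(1)) auto
    then show "f x + f y \<le> f (x + y)"
      using g(2)[OF xy(1), of 1] by simp
  qed
  have f0: "f 0 = 0" using sublinear_onD(3)[OF f(1) z] .
  have neg: "f (- x) = - f x" if "x \<in> V" for x
    using add[OF that Vi(3)[OF that]] f0 by simp
  have "f (c *\<^sub>R x) = c * f x" if x: "x \<in> V" for c x
  proof (cases "c \<ge> 0")
    case True
    then show ?thesis using sublinear_onD(2)[OF f(1) x] by simp
  next
    case False
    then have "f ((- c) *\<^sub>R x) = (- c) * f x" by (intro sublinear_onD(2)[OF f(1) x]) simp
    then show ?thesis using neg[of "c *\<^sub>R x"] x Vi by simp
  qed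
  moreover have "f x \<le> p x" if "x \<in> V" for x
    using f(2)[OF that] q(2)[OF that, of 0] by simp
  moreover have "f z = p z"
  proof (rule antisym)
    have "f (- z) \<le> q (- z)" using f(2) z Vi by simp
    also have "\<dots> \<le> - p z"
      using q(2)[of "- z" 1] z Vi sublinear_onD(3)[OF p z] by simp
    finally show "p z \<le> f z" using neg[OF z] by simp
  qed (use calculation z in auto)
  ultimately show ?thesis using that add by blast
qed

section \<open>Separation in L1\<close>

text \<open>The duality of L1 and L-infinity for positive functionals: the values on indicators form
  a measure below \<open>Q\<close>, whose Radon-Nikodym density represents \<open>f\<close> on
  indicators, and then on all integrable functions by linearity and the L1-bound.\<close>

lemma L1_positive_functional_density:
  fixes f :: "('a \<Rightarrow> real) \<Rightarrow> real"
  assumes Q: "finite_measure Q"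
    and add: "\<And>x y. integrable Q x \<Longrightarrow> integrable Q y \<Longrightarrow> f (\<lambda>\<omega>. x \<omega> + y \<omega>) = f x + f y"
    and scale: "\<And>c x. integrable Q x \<Longrightarrow> f (\<lambda>\<omega>. c * x \<omega>) = c * f x"
    and bound: "\<And>x. integrable Q x \<Longrightarrow> f x \<le> (\<integral>\<omega>. \<bar>x \<omega>\<bar> \<partial>Q)"
    and pos: "\<And>A. A \<in> sets Q \<Longrightarrow> 0 \<le> f (indicator A)"
  obtains Y where "Y \<in> borel_measurable Q" "\<And>\<omega>. 0 \<le> Y \<omega>" "\<And>\<omega>. Y \<omega> \<le> 1"
    and "\<And>x. integrable Q x \<Longrightarrow> f x = (\<integral>\<omega>. Y \<omega> * x \<omega> \<partial>Q)"
proof -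
  interpret Q: finite_measure Q by fact
  have f0: "f (\<lambda>\<omega>. 0) = 0"
    using scale[of "\<lambda>\<omega>. 0" 0] by simp
  have int_ind: "integrable Q (indicator A :: 'a \<Rightarrow> real)" if "A \<in> sets Q" for A
    using that by (simp add: Q.emeasure_eq_measure)
  have f_ind_le: "f (indicator A) \<le> measure Q A" if "A \<in> sets Q" for A
    using bound[OF int_ind[OF that]] that by simp
  have diff: "f (\<lambda>\<omega>. x \<omega> - y \<omega>) = f x - f y" if "integrable Q x" "integrable Q y" for x y
    using add[of x "\<lambda>\<omega>. (- 1) * y \<omega>"] scale[of y "- 1"] that by simp
  \<comment> \<open>The one-sided bound applied to both differences makes \<open>f\<close>
    1-Lipschitz for the L1-distance; the passage to limits at the end rests on this.\<close>
  have abs_bound: "\<bar>f x - f y\<bar> \<le> (\<integral>\<omega>. \<bar>x \<omega> - y \<omega>\<bar> \<partial>Q)"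
    if "integrable Q x" "integrable Q y" for x y
    using bound[of "\<lambda>\<omega>. x \<omega> - y \<omega>"] bound[of "\<lambda>\<omega>. y \<omega> - x \<omega>"] diff that
    by (simp add: abs_le_iff abs_minus_commute)
  let ?\<nu> = "\<lambda>A. ennreal (f (indicator A))"
  define N where "N = measure_of (space Q) (sets Q) ?\<nu>"
  have positive: "positive (sets Q) ?\<nu>"
  proof -
    have "indicator {} = (\<lambda>\<omega>::'a. 0::real)" by (simp add: fun_eq_iff)
    then show ?thesis using f0 by (simp add: positive_def)
  qed
  have additive: "additive (sets Q) ?\<nu>"
  proof (unfold additive_def, intro ballI impI)
    fix A B assume AB: "A \<in> sets Q" "B \<in> sets Q" "A \<inter> B = {}"
    then have "indicator (A \<union> B) = (\<lambda>\<omega>. indicator A \<omega> + indicator B \<omega> :: real)"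
      by (auto simp: fun_eq_iff indicator_def)
    then show "?\<nu> (A \<union> B) = ?\<nu> A + ?\<nu> B"
      using add[OF int_ind int_ind] pos AB by (simp add: ennreal_plus)
  qed
  \<comment> \<open>Finite additivity upgrades to countable additivity through continuity at the
    empty set, where \<open>f (indicator (A i)) \<le> measure Q (A i)\<close> forces the limit
    0.\<close>
  have "countably_additive (sets Q) ?\<nu>"
  proof (rule sets.empty_continuous_imp_countably_additive[OF positive additive])
    fix A :: "nat \<Rightarrow> 'a set" assume A: "range A \<subseteq> sets Q" "decseq A" "(\<Inter>i. A i) = {}"
    have "(\<lambda>i. measure Q (A i)) \<longlonglongrightarrow> measure Q (\<Inter>i. A i)"
      using A by (intro Q.finite_Lim_measure_decseq) auto
    then have "(\<lambda>i. measure Q (A i)) \<longlonglongrightarrow> 0"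
      using A by simp
    moreover have "\<forall>\<^sub>F i in sequentially. norm (f (indicator (A i))) \<le> measure Q (A i)"
      using pos f_ind_le A(1) by (intro always_eventually) auto
    ultimately have "(\<lambda>i. f (indicator (A i))) \<longlonglongrightarrow> 0"
      by (rule Lim_null_comparison[rotated])
    then show "(\<lambda>i. ?\<nu> (A i)) \<longlonglongrightarrow> 0"
      using tendsto_ennrealI[of _ 0] by simp
  qed auto
  then have N: "emeasure N A = ?\<nu> A" if "A \<in> sets Q" for A
    unfolding N_def using that positive
    by (intro emeasure_measure_of_sigma) (auto intro: sets.sigma_algebra_axioms)
  have sets_N [simp]: "sets N = sets Q"
    by (simp add: N_def)
  have N_le: "emeasure N A \<le> emeasure Q A" if "A \<in> sets Q" for A
    using f_ind_le that by (auto simp: N Q.emeasure_eq_measure intro: ennreal_leI)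
  have "absolutely_continuous Q N"
    unfolding absolutely_continuous_def null_sets_def
  proof (clarsimp)
    fix A assume "A \<in> sets Q" "emeasure Q A = 0"
    then show "emeasure N A = 0" using N_le[of A] by simp
  qed
  then obtain g where g: "g \<in> borel_measurable Q" "density Q g = N"
    using Q.Radon_Nikodym[of N] by auto
  have g_le: "AE \<omega> in Q. g \<omega> \<le> 1"
  proof -
    let ?A = "{\<omega>\<in>space Q. 1 < g \<omega>}"
    have A: "?A \<in> sets Q" using g by measurable
    \<comment> \<open>On \<open>?A\<close> the density splits as \<open>(g - 1) + 1\<close>, so
      \<open>N\<close> exceeds \<open>Q\<close> there by the first integral, while \<open>N\<close>
      is at most \<open>Q\<close>. The mass of \<open>?A\<close> under \<open>Q\<close> is finite
      and cancels, leaving 0 for the excess.\<close>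
    have "(\<integral>\<^sup>+\<omega>. (g \<omega> - 1) * indicator ?A \<omega> \<partial>Q) + emeasure Q ?A
        = (\<integral>\<^sup>+\<omega>. (g \<omega> - 1) * indicator ?A \<omega> + indicator ?A \<omega> \<partial>Q)"
      using g(1) A by (subst nn_integral_add) auto
    also have "\<dots> = (\<integral>\<^sup>+\<omega>. g \<omega> * indicator ?A \<omega> \<partial>Q)"
      by (intro nn_integral_cong) (auto simp: indicator_def diff_add_cancel_ennreal)
    also have "\<dots> = emeasure N ?A"
      using g A by (auto simp: emeasure_density)
    also have "\<dots> \<le> emeasure Q ?A"
      using A by (rule N_le)
    finally have "(\<integral>\<^sup>+\<omega>. (g \<omega> - 1) * indicator ?A \<omega> \<partial>Q) \<le> 0"
      using ennreal_add_left_cancel_le[of "emeasure Q ?A" "\<integral>\<^sup>+\<omega>. (g \<omega> - 1) * indicator ?A \<omega> \<partial>Q" 0]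
      by (simp add: add.commute)
    then have "AE \<omega> in Q. (g \<omega> - 1) * indicator ?A \<omega> = 0"
      using g(1) A by (subst (asm) le_zero_eq, subst (asm) nn_integral_0_iff_AE) auto
    then show ?thesis
      using AE_space by eventually_elim
        (auto simp: indicator_def not_le[symmetric] diff_eq_0_iff_ennreal split: if_splits)
  qed
  \<comment> \<open>Capping at 1 makes the bounds hold at every point instead of almost everywhere,
    and keeps \<open>enn2real\<close> away from infinity.\<close>
  define Y where "Y = (\<lambda>\<omega>. enn2real (min (g \<omega>) 1))"
  have Y_meas [measurable]: "Y \<in> borel_measurable Q"
    unfolding Y_def using g(1) by measurable
  have Y0: "0 \<le> Y \<omega>" for \<omega> by (simp add: Y_def)
  have Y1: "Y \<omega> \<le> 1" for \<omega>
    unfolding Y_def by (rule enn2real_leI) auto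
  have gY: "AE \<omega> in Q. g \<omega> = ennreal (Y \<omega>)"
    using g_le by eventually_elim (simp add: Y_def min_def le_less_trans[OF _ ennreal_one_less_top])
  have Y_int: "integrable Q (\<lambda>\<omega>. Y \<omega> * x \<omega>)" if "integrable Q x" for x :: "'a \<Rightarrow> real"
    by (rule Bochner_Integration.integrable_bound[OF that])
      (use that Y0 Y1 in \<open>auto simp: abs_mult intro!: AE_I2 mult_left_le_one_le\<close>)
  have base: "f (indicator A) = (\<integral>\<omega>. Y \<omega> * indicator A \<omega> \<partial>Q)" if A: "A \<in> sets Q" for A
  proof -
    have "?\<nu> A = (\<integral>\<^sup>+\<omega>. g \<omega> * indicator A \<omega> \<partial>Q)"
      using N[OF A] g A by (metis emeasure_density)
    also have "\<dots> = (\<integral>\<^sup>+\<omega>. ennreal (Y \<omega> * indicator A \<omega>) \<partial>Q)"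
      using gY by (intro nn_integral_cong_AE, eventually_elim) (auto simp: indicator_def)
    also have "\<dots> = ennreal (\<integral>\<omega>. Y \<omega> * indicator A \<omega> \<partial>Q)"
      using Y_int[OF int_ind[OF A]] Y0 by (intro nn_integral_eq_integral) auto
    finally show ?thesis
      using pos[OF A] Y0 by (subst (asm) ennreal_inj) (auto intro!: integral_nonneg_AE)
  qed
  have "f x = (\<integral>\<omega>. Y \<omega> * x \<omega> \<partial>Q)" if "integrable Q x" for x
    using that
  proof (induction rule: integrable_induct)
    case (base A c)
    have "f (\<lambda>\<omega>. c * indicator A \<omega>) = c * (\<integral>\<omega>. Y \<omega> * indicator A \<omega> \<partial>Q)"
      using scale[OF int_ind] \<open>\<And>A. A \<in> sets Q \<Longrightarrow> f (indicator A) = _\<close>[of A] base by simp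
    also have "\<dots> = (\<integral>\<omega>. Y \<omega> * (c * indicator A \<omega>) \<partial>Q)"
      by (simp add: mult.left_commute)
    finally show ?case by (simp add: mult.commute)
  next
    case (add x y)
    then show ?case
      using \<open>\<And>x y. integrable Q x \<Longrightarrow> integrable Q y \<Longrightarrow> f (\<lambda>\<omega>. x \<omega> + y \<omega>) = _\<close>[of x y] Y_int
      by (simp add: distrib_left)
  next
    case (lim x s)
    have s: "\<And>i. integrable Q (s i)" "\<And>i. f (s i) = (\<integral>\<omega>. Y \<omega> * s i \<omega> \<partial>Q)"
      "\<And>\<omega>. \<omega> \<in> space Q \<Longrightarrow> (\<lambda>i. s i \<omega>) \<longlonglongrightarrow> x \<omega>"
      "\<And>i \<omega>. \<omega> \<in> space Q \<Longrightarrow> norm (s i \<omega>) \<le> 2 * norm (x \<omega>)" "integrable Q x"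
      by fact+
    \<comment> \<open>Dominated convergence gives L1-convergence of the approximants, which the
      Lipschitz bound transfers to the values of \<open>f\<close>.\<close>
    have L: "(\<lambda>i. \<integral>\<omega>. \<bar>s i \<omega> - x \<omega>\<bar> \<partial>Q) \<longlonglongrightarrow> (\<integral>\<omega>. 0 \<partial>Q)"
    proof (rule integral_dominated_convergence[where w = "\<lambda>\<omega>. 3 * \<bar>x \<omega>\<bar>"])
      show "AE \<omega> in Q. (\<lambda>i. \<bar>s i \<omega> - x \<omega>\<bar>) \<longlonglongrightarrow> 0"
        using s(3) by (intro AE_I2 tendsto_rabs_zero LIM_zero) auto
      show "AE \<omega> in Q. norm \<bar>s i \<omega> - x \<omega>\<bar> \<le> 3 * \<bar>x \<omega>\<bar>" for i
      proof (rule AE_I2)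
        fix \<omega> assume "\<omega> \<in> space Q"
        then show "norm \<bar>s i \<omega> - x \<omega>\<bar> \<le> 3 * \<bar>x \<omega>\<bar>"
          using s(4)[of \<omega> i] by simp
      qed
    qed (use s in auto)
    have "\<forall>\<^sub>F i in sequentially. norm (f (s i) - f x) \<le> (\<integral>\<omega>. \<bar>s i \<omega> - x \<omega>\<bar> \<partial>Q)"
      using abs_bound s(1,5) by (intro always_eventually) auto
    then have "(\<lambda>i. f (s i) - f x) \<longlonglongrightarrow> 0"
      by (rule Lim_null_comparison) (use L in simp)
    then have "(\<lambda>i. f (s i)) \<longlonglongrightarrow> f x"
      by (rule LIM_zero_cancel)
    moreover have "(\<lambda>i. \<integral>\<omega>. Y \<omega> * s i \<omega> \<partial>Q) \<longlonglongrightarrow> (\<integral>\<omega>. Y \<omega> * x \<omega> \<partial>Q)"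
    proof (rule integral_dominated_convergence[where w = "\<lambda>\<omega>. 2 * \<bar>x \<omega>\<bar>"])
      show "AE \<omega> in Q. (\<lambda>i. Y \<omega> * s i \<omega>) \<longlonglongrightarrow> Y \<omega> * x \<omega>"
        using s(3) by (intro AE_I2 tendsto_mult_left) auto
      show "AE \<omega> in Q. norm (Y \<omega> * s i \<omega>) \<le> 2 * \<bar>x \<omega>\<bar>" for i
      proof (rule AE_I2)
        fix \<omega> assume "\<omega> \<in> space Q"
        then show "norm (Y \<omega> * s i \<omega>) \<le> 2 * \<bar>x \<omega>\<bar>"
          using s(4)[of \<omega> i] mult_left_le_one_le[of "\<bar>s i \<omega>\<bar>" "Y \<omega>"] Y0[of \<omega>] Y1[of \<omega>]
          by (simp add: abs_mult)
      qed
    qed (use s in auto)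
    ultimately show ?case
      using s(2) by (simp add: LIMSEQ_unique)
  qed
  then show ?thesis using that Y_meas Y0 Y1 by blast
qed

text \<open>Hahn-Banach is applied to the L1-distance from the cone, which is sublinear.\<close>

lemma L1_cone_separation:
  fixes C :: "('a \<Rightarrow> real) set"
  assumes Q: "finite_measure Q"
    and C_int: "\<And>Z. Z \<in> C \<Longrightarrow> integrable Q Z"
    and C_add: "\<And>Z Z'. Z \<in> C \<Longrightarrow> Z' \<in> C \<Longrightarrow> (\<lambda>\<omega>. Z \<omega> + Z' \<omega>) \<in> C"
    and C_scale: "\<And>Z c. Z \<in> C \<Longrightarrow> c \<ge> 0 \<Longrightarrow> (\<lambda>\<omega>. c * Z \<omega>) \<in> C"
    and C_ind: "\<And>A. A \<in> sets Q \<Longrightarrow> (\<lambda>\<omega>. - indicator A \<omega>) \<in> C"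
    and X: "integrable Q X" and e: "e > 0" "\<And>Z. Z \<in> C \<Longrightarrow> e \<le> (\<integral>\<omega>. \<bar>X \<omega> - Z \<omega>\<bar> \<partial>Q)"
  obtains Y where "Y \<in> borel_measurable Q" "\<And>\<omega>. 0 \<le> Y \<omega>" "\<And>\<omega>. Y \<omega> \<le> 1"
    and "\<And>Z. Z \<in> C \<Longrightarrow> (\<integral>\<omega>. Y \<omega> * Z \<omega> \<partial>Q) \<le> 0" and "0 < (\<integral>\<omega>. Y \<omega> * X \<omega> \<partial>Q)"
proof -
  interpret Q: finite_measure Q by fact
  let ?d = "\<lambda>x Z :: 'a \<Rightarrow> real. \<integral>\<omega>. \<bar>x \<omega> - Z \<omega>\<bar> \<partial>Q"
  define V :: "('a \<Rightarrow> real) set" where "V = {x. integrable Q x}"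
  define p where "p = (\<lambda>x. INF Z\<in>C. ?d x Z)"
  \<comment> \<open>The empty event puts 0 into \<open>C\<close>, so the infimum runs over a
    nonempty set and \<open>p\<close> is at most the L1-norm.\<close>
  have C0: "(\<lambda>\<omega>. 0) \<in> C"
    using C_ind[of "{}"] by simp
  have V: "subspace V"
    by (auto simp: subspace_def V_def plus_fun_def zero_fun_def scaleR_fun_def)
  have le: "p x \<le> ?d x Z" if "Z \<in> C" for x Z
    unfolding p_def using that by (intro cINF_lower bdd_belowI2[where m = 0]) auto
  have ge: "c \<le> p x" if "\<And>Z. Z \<in> C \<Longrightarrow> c \<le> ?d x Z" for c x
    unfolding p_def using that C0 by (intro cINF_greatest) auto
  have "sublinear_on V p"
  proof (rule sublinear_onI)
    fix x y assume xy: "x \<in> V" "y \<in> V"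
    have *: "p (x + y) \<le> ?d x Z + ?d y Z'" if Z: "Z \<in> C" "Z' \<in> C" for Z Z'
    proof -
      have "p (x + y) \<le> (\<integral>\<omega>. \<bar>(x + y) \<omega> - (Z \<omega> + Z' \<omega>)\<bar> \<partial>Q)"
        using le[OF C_add[OF Z]] .
      also have "\<dots> \<le> (\<integral>\<omega>. \<bar>x \<omega> - Z \<omega>\<bar> + \<bar>y \<omega> - Z' \<omega>\<bar> \<partial>Q)"
        using xy C_int Z by (intro integral_mono) (auto simp: V_def)
      also have "\<dots> = ?d x Z + ?d y Z'"
        using xy C_int Z by (intro Bochner_Integration.integral_add) (auto simp: V_def)
      finally show ?thesis .
    qed
    have "p (x + y) - ?d x Z \<le> p y" if "Z \<in> C" for Z
      using *[OF that] by (intro ge) (auto simp: algebra_simps)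
    then have "p (x + y) - p y \<le> p x"
      by (intro ge) (auto simp: algebra_simps)
    then show "p (x + y) \<le> p x + p y" by simp
  next
    fix x and t :: real assume t: "t > 0"
    have eq: "?d (t *\<^sub>R x) (\<lambda>\<omega>. t * Z \<omega>) = t * ?d x Z" for Z
    proof -
      have "\<bar>(t *\<^sub>R x) \<omega> - t * Z \<omega>\<bar> = t * \<bar>x \<omega> - Z \<omega>\<bar>" for \<omega>
        using t by (simp add: scaleR_fun_def abs_mult right_diff_distrib[symmetric])
      then show ?thesis by simp
    qed
    have "p (t *\<^sub>R x) / t \<le> p x"
    proof (rule ge)
      fix Z assume "Z \<in> C"
      then show "p (t *\<^sub>R x) / t \<le> ?d x Z"
        using le[OF C_scale[of Z t], of "t *\<^sub>R x"] t eq by (simp add: divide_le_eq mult.commute)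
    qed
    moreover have "t * p x \<le> p (t *\<^sub>R x)"
    proof (rule ge)
      fix Z assume "Z \<in> C"
      \<comment> \<open>Division by \<open>t\<close> keeps \<open>Z\<close> in the cone, which
        yields the inequality in the other direction.\<close>
      then have "p x \<le> ?d x (\<lambda>\<omega>. 1 / t * Z \<omega>)"
        using t by (intro le C_scale) auto
      then have "t * p x \<le> t * ?d x (\<lambda>\<omega>. 1 / t * Z \<omega>)"
        using t by simp
      also have "\<dots> = ?d (t *\<^sub>R x) Z"
        using eq[of "\<lambda>\<omega>. 1 / t * Z \<omega>"] t by simp
      finally show "t * p x \<le> ?d (t *\<^sub>R x) Z" .
    qed
    ultimately show "p (t *\<^sub>R x) = t * p x"
      using t by (simp add: divide_le_eq mult.commute)
  next
    have "p 0 \<le> 0" using le[OF C0, of 0] by simp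
    moreover have "0 \<le> p 0" by (intro ge) auto
    ultimately show "p 0 = 0" by simp
  qed
  \<comment> \<open>Equality at \<open>X\<close> gives \<open>f X = p X \<ge> e\<close>, while
    \<open>p\<close> vanishes on \<open>C\<close>, so \<open>f\<close> is nonpositive there.\<close>
  from this V obtain f where f: "\<And>x y. x \<in> V \<Longrightarrow> y \<in> V \<Longrightarrow> f (x + y) = f x + f y"
      "\<And>c x. x \<in> V \<Longrightarrow> f (c *\<^sub>R x) = c * f x" "\<And>x. x \<in> V \<Longrightarrow> f x \<le> p x" "f X = p X"
    by (rule Hahn_Banach_sublinear[where z = X]) (use X in \<open>simp add: V_def\<close>, blast)
  have fC: "f Z \<le> 0" if "Z \<in> C" for Z
    using f(3)[of Z] le[OF that, of Z] C_int[OF that] by (simp add: V_def)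
  have scale: "f (\<lambda>\<omega>. c * x \<omega>) = c * f x" if "integrable Q x" for c x
    using f(2)[of x c] that by (simp add: V_def scaleR_fun_def)
  obtain Y where Y: "Y \<in> borel_measurable Q" "\<And>\<omega>. 0 \<le> Y \<omega>" "\<And>\<omega>. Y \<omega> \<le> 1"
      "\<And>x. integrable Q x \<Longrightarrow> f x = (\<integral>\<omega>. Y \<omega> * x \<omega> \<partial>Q)"
  proof (rule L1_positive_functional_density[OF Q, of f])
    show "f (\<lambda>\<omega>. x \<omega> + y \<omega>) = f x + f y" if "integrable Q x" "integrable Q y" for x y
      using f(1)[of x y] that by (simp add: V_def plus_fun_def)
    show "f x \<le> (\<integral>\<omega>. \<bar>x \<omega>\<bar> \<partial>Q)" if "integrable Q x" for x
      using f(3)[of x] le[OF C0, of x] that by (simp add: V_def)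
    show "0 \<le> f (indicator A)" if "A \<in> sets Q" for A
      using fC[OF C_ind[OF that]] scale[of "indicator A" "- 1"] that
      by (simp add: Q.emeasure_eq_measure)
  qed (use scale in auto)
  have "0 < f X"
    using e ge[of e X] f(4) by fastforce
  with Y fC C_int X show ?thesis
    using that by metis
qed

section \<open>Pricing measures and their densities\<close>

lemma e2ennreal_add:
  assumes "0 \<le> a" "0 \<le> b"
  shows "e2ennreal (a + b) = e2ennreal a + e2ennreal b"
  using assms by (metis e2ennreal_enn2ereal enn2ereal_e2ennreal plus_ennreal.rep_eq)

lemma e2ennreal_mult:
  assumes "0 \<le> a" "0 \<le> b"
  shows "e2ennreal (a * b) = e2ennreal a * e2ennreal b"
  using assms by (metis e2ennreal_enn2ereal enn2ereal_e2ennreal times_ennreal.rep_eq)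

lemma pos_part_nonneg [simp]: "0 \<le> pos_part \<Phi> y"
  by (simp add: pos_part_def)

lemma penalty_function_convex:
  assumes "penalty_function \<Phi>" "0 \<le> x" "0 \<le> y" "0 \<le> u" "u \<le> 1"
  shows "\<Phi> (u * x + (1 - u) * y) \<le> ereal u * \<Phi> x + ereal (1 - u) * \<Phi> y"
  using assms by (simp add: penalty_function_def)

text \<open>Only finiteness of the penalty integral is at stake, so the weights 1/2 may be dropped:
  half of \<open>\<Phi> z\<close> is at most its positive part, also when \<open>\<Phi> z\<close> is
  negative or infinite.\<close>

lemma penalty_function_midpoint:
  assumes "penalty_function \<Phi>" "0 \<le> x" "0 \<le> y"
  shows "e2ennreal (pos_part \<Phi> ((x + y) / 2)) \<le> e2ennreal (pos_part \<Phi> x) + e2ennreal (pos_part \<Phi> y)"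
proof -
  have half: "ereal (1 / 2) * \<Phi> z \<le> pos_part \<Phi> z" for z
    by (cases "\<Phi> z") (auto simp: pos_part_def max_def)
  have "\<Phi> (1 / 2 * x + (1 - 1 / 2) * y) \<le> ereal (1 / 2) * \<Phi> x + ereal (1 - 1 / 2) * \<Phi> y"
    using assms by (intro penalty_function_convex) auto
  then have "\<Phi> ((x + y) / 2) \<le> ereal (1 / 2) * \<Phi> x + ereal (1 / 2) * \<Phi> y"
    by (simp add: field_simps)
  also have "\<dots> \<le> pos_part \<Phi> x + pos_part \<Phi> y"
    by (intro add_mono half)
  finally have "pos_part \<Phi> ((x + y) / 2) \<le> pos_part \<Phi> x + pos_part \<Phi> y"
    unfolding pos_part_def[of \<Phi> "(x + y) / 2"] by simp
  then show ?thesis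
    by (simp add: e2ennreal_add[symmetric] e2ennreal_mono)
qed

text \<open>The growth condition concerns \<open>y > 0\<close>. At \<open>y = 0\<close> scaling does
  nothing, so the coefficient merely has to be at least 1, even if \<open>\<Phi> 0\<close> is
  infinite; this is the origin of \<open>\<alpha> + 1\<close>.\<close>

lemma growth_condition_bound:
  assumes "growth_condition \<Phi>" "0 < l0"
  obtains \<alpha> \<beta> where "0 \<le> \<alpha>" "0 \<le> \<beta>"
    "\<And>l y. l0 \<le> l \<Longrightarrow> l \<le> l1 \<Longrightarrow> 0 \<le> y \<Longrightarrow> e2ennreal (pos_part \<Phi> (l * y)) \<le>
      ennreal (\<alpha> + 1) * e2ennreal (pos_part \<Phi> y) + ennreal (\<beta> * (y + 1))"
proof (cases "l0 \<le> l1")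
  case True
  then obtain \<alpha> \<beta> where ab: "\<alpha> > 0" "\<beta> > 0"
    "\<forall>y>0. \<forall>l\<in>{l0..l1}.
      pos_part \<Phi> (l * y) \<le> ereal \<alpha> * pos_part \<Phi> y + ereal (\<beta> * (y + 1))"
    using assms(1)[unfolded growth_condition_def, rule_format, OF conjI[OF assms(2) True]] by metis
  have "e2ennreal (pos_part \<Phi> (l * y)) \<le>
      ennreal (\<alpha> + 1) * e2ennreal (pos_part \<Phi> y) + ennreal (\<beta> * (y + 1))"
    if l: "l0 \<le> l" "l \<le> l1" and "0 \<le> y" for l y
  proof (cases "y = 0")
    case True
    have "1 * e2ennreal (pos_part \<Phi> 0) \<le> ennreal (\<alpha> + 1) * e2ennreal (pos_part \<Phi> 0)"
      using ab by (intro mult_right_mono) auto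
    with True show ?thesis by (simp add: add_increasing2)
  next
    case False
    with that have y: "y > 0" by simp
    have "e2ennreal (pos_part \<Phi> (l * y)) \<le> e2ennreal (ereal \<alpha> * pos_part \<Phi> y + ereal (\<beta> * (y + 1)))"
      using ab(3) y l by (intro e2ennreal_mono) simp
    also have "\<dots> = ennreal \<alpha> * e2ennreal (pos_part \<Phi> y) + ennreal (\<beta> * (y + 1))"
      using ab y by (simp add: e2ennreal_add e2ennreal_mult)
    also have "\<dots> \<le> ennreal (\<alpha> + 1) * e2ennreal (pos_part \<Phi> y) + ennreal (\<beta> * (y + 1))"
      using ab by (intro add_right_mono mult_right_mono ennreal_leI) auto
    finally show ?thesis .
  qed
  with ab show ?thesis
    by (intro that[of \<alpha> \<beta>]) auto
next
  case False
  then show ?thesis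
    by (intro that[of 0 0]) auto
qed

text \<open>A finite convex function on the open half-line is continuous there, hence Borel. The
  point 0 is treated apart, since \<open>\<Phi>\<close> may jump or be infinite there.\<close>

lemma penalty_function_measurable:
  assumes \<Phi>: "penalty_function \<Phi>" and q: "q \<in> borel_measurable P" "\<And>\<omega>. 0 \<le> q \<omega>"
  shows "(\<lambda>\<omega>. e2ennreal (pos_part \<Phi> (q \<omega>))) \<in> borel_measurable P"
proof -
  define \<phi> where "\<phi> y = real_of_ereal (\<Phi> y)" for y
  have \<phi>: "\<Phi> y = ereal (\<phi> y)" if "y > 0" for y
    using \<Phi> that by (cases "\<Phi> y") (auto simp: penalty_function_def \<phi>_def dest: less_imp_le)
  have "convex_on {0<..} \<phi>"
  proof (rule convex_onI)
    fix t x y :: real assume t: "0 < t" "t < 1" and xy: "x \<in> {0<..}" "y \<in> {0<..}"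
    then have pos: "0 < (1 - t) * x + t * y"
      by (intro add_pos_pos mult_pos_pos) auto
    have "\<Phi> ((1 - t) * x + (1 - (1 - t)) * y) \<le> ereal (1 - t) * \<Phi> x + ereal (1 - (1 - t)) * \<Phi> y"
      using t xy by (intro penalty_function_convex[OF \<Phi>]) auto
    then show "\<phi> ((1 - t) *\<^sub>R x + t *\<^sub>R y) \<le> (1 - t) * \<phi> x + t * \<phi> y"
      using \<phi> pos xy by simp
  qed auto
  then have "continuous_on {0<..} \<phi>"
    by (intro convex_on_continuous) auto
  then have [measurable]: "(\<lambda>y. if y \<in> {0<..} then \<phi> y else 0) \<in> borel_measurable borel"
    by (intro borel_measurable_continuous_on_if) auto
  have "(\<lambda>\<omega>. if q \<omega> = 0 then e2ennreal (pos_part \<Phi> 0)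
      else ennreal (max ((\<lambda>y. if y \<in> {0<..} then \<phi> y else 0) (q \<omega>)) 0)) \<in> borel_measurable P"
    using q(1) by measurable
  also have "(\<lambda>\<omega>. if q \<omega> = 0 then e2ennreal (pos_part \<Phi> 0)
      else ennreal (max ((\<lambda>y. if y \<in> {0<..} then \<phi> y else 0) (q \<omega>)) 0)) =
      (\<lambda>\<omega>. e2ennreal (pos_part \<Phi> (q \<omega>)))"
  proof
    fix \<omega>
    have "e2ennreal (pos_part \<Phi> y) = ennreal (max (\<phi> y) 0)" if "y > 0" for y
      using \<phi>[OF that] by (auto simp: pos_part_def max_def ennreal_neg)
    then show "(if q \<omega> = 0 then e2ennreal (pos_part \<Phi> 0)
      else ennreal (max ((\<lambda>y. if y \<in> {0<..} then \<phi> y else 0) (q \<omega>)) 0)) = e2ennreal (pos_part \<Phi> (q \<omega>))"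
      using q(2)[of \<omega>] by (cases "q \<omega> = 0") auto
  qed
  finally show ?thesis .
qed

section \<open>Densities of pricing measures and stability of \<open>M_Phi\<close>\<close>

lemma density_of_measurable [measurable]: "density_of P Q \<in> borel_measurable P"
  unfolding density_of_def by measurable

lemma density_of_nonneg [simp]: "0 \<le> density_of P Q \<omega>"
  by (simp add: density_of_def)

lemma integrable_density_of_iff:
  assumes "prob_space P" "prob_space Q" "sets Q = sets P" "absolutely_continuous P Q"
    and "f \<in> borel_measurable P"
  shows "integrable Q f \<longleftrightarrow> integrable P (\<lambda>\<omega>. f \<omega> * density_of P Q \<omega>)"
    and "(\<integral>\<omega>. f \<omega> \<partial>Q) = (\<integral>\<omega>. f \<omega> * density_of P Q \<omega> \<partial>P)"
proof -
  interpret P: prob_space P by fact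
  interpret Q: prob_space Q by fact
  note RN = P.RN_deriv_integrable[OF Q.sigma_finite_measure_axioms assms(4,3,5)]
    P.RN_deriv_integral[OF Q.sigma_finite_measure_axioms assms(4,3,5)]
  show "integrable Q f \<longleftrightarrow> integrable P (\<lambda>\<omega>. f \<omega> * density_of P Q \<omega>)"
    "(\<integral>\<omega>. f \<omega> \<partial>Q) = (\<integral>\<omega>. f \<omega> * density_of P Q \<omega> \<partial>P)"
    using RN by (simp_all add: density_of_def mult.commute)
qed

lemma M_PhiD:
  assumes "Q \<in> M_Phi P F T S \<Phi>"
  shows "prob_space Q" "sets Q = sets P" "absolutely_continuous P Q"
    and "K_adm P F T S \<subseteq> L1 P Q" "\<And>X. X \<in> K_adm P F T S \<Longrightarrow> (\<integral>\<omega>. X \<omega> \<partial>Q) \<le> 0"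
    and "(\<integral>\<^sup>+\<omega>. e2ennreal (pos_part \<Phi> (density_of P Q \<omega>)) \<partial>P) < \<infinity>"
  using assms by (auto simp: M_Phi_def M1_adm_def)

lemma M_Phi_density_of:
  assumes P: "prob_space P" and Q: "Q \<in> M_Phi P F T S \<Phi>"
  shows "f \<in> borel_measurable P \<Longrightarrow> integrable Q f \<longleftrightarrow> integrable P (\<lambda>\<omega>. f \<omega> * density_of P Q \<omega>)"
    and "f \<in> borel_measurable P \<Longrightarrow> (\<integral>\<omega>. f \<omega> \<partial>Q) = (\<integral>\<omega>. f \<omega> * density_of P Q \<omega> \<partial>P)"
    and "integrable P (density_of P Q)" "(\<integral>\<omega>. density_of P Q \<omega> \<partial>P) = 1"
    and "AE \<omega> in P. R \<omega> \<Longrightarrow> AE \<omega> in Q. R \<omega>"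
proof -
  note iff = integrable_density_of_iff[OF P M_PhiD(1-3)[OF Q]]
  interpret Q: prob_space Q using M_PhiD(1)[OF Q] .
  show "f \<in> borel_measurable P \<Longrightarrow> integrable Q f \<longleftrightarrow> integrable P (\<lambda>\<omega>. f \<omega> * density_of P Q \<omega>)"
    "f \<in> borel_measurable P \<Longrightarrow> (\<integral>\<omega>. f \<omega> \<partial>Q) = (\<integral>\<omega>. f \<omega> * density_of P Q \<omega> \<partial>P)"
    by (rule iff(1), assumption) (rule iff(2), assumption)
  show "integrable P (density_of P Q)" "(\<integral>\<omega>. density_of P Q \<omega> \<partial>P) = 1"
    using iff[of "\<lambda>_. 1"] Q.prob_space by simp_all
  show "AE \<omega> in P. R \<omega> \<Longrightarrow> AE \<omega> in Q. R \<omega>"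
    using M_PhiD(2,3)[OF Q] by (rule absolutely_continuous_AE)
qed

text \<open>Turns a candidate density into a pricing measure. Radon-Nikodym derivatives are unique
  only almost everywhere, hence the almost sure identification of the density.\<close>

lemma M_Phi_ex_density:
  assumes P: "prob_space P"
    and q: "integrable P q" "\<And>\<omega>. 0 \<le> q \<omega>" "(\<integral>\<omega>. q \<omega> \<partial>P) = 1"
    and K_int: "\<And>X. X \<in> K_adm P F T S \<Longrightarrow> integrable P (\<lambda>\<omega>. X \<omega> * q \<omega>)"
    and K_le: "\<And>X. X \<in> K_adm P F T S \<Longrightarrow> (\<integral>\<omega>. X \<omega> * q \<omega> \<partial>P) \<le> 0"
    and fin: "(\<integral>\<^sup>+\<omega>. e2ennreal (pos_part \<Phi> (q \<omega>)) \<partial>P) < \<infinity>"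
  obtains Q where "Q \<in> M_Phi P F T S \<Phi>" "AE \<omega> in P. density_of P Q \<omega> = q \<omega>"
proof -
  interpret P: prob_space P by fact
  have [measurable]: "q \<in> borel_measurable P" using q by simp
  define Q where "Q = density P (\<lambda>\<omega>. ennreal (q \<omega>))"
  have dens: "AE \<omega> in P. density_of P Q \<omega> = q \<omega>"
  proof -
    have "AE \<omega> in P. ennreal (q \<omega>) = RN_deriv P Q \<omega>"
      by (rule P.RN_deriv_unique) (simp_all add: Q_def)
    then show ?thesis
      by eventually_elim (metis density_of_def enn2real_ennreal q(2))
  qed
  have sets [simp]: "sets Q = sets P" by (simp add: Q_def)
  have "prob_space Q"
  proof
    show "emeasure Q (space Q) = 1"
      using q by (simp add: Q_def emeasure_density nn_integral_eq_integral)
  qed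
  moreover have "absolutely_continuous P Q"
    unfolding Q_def by (rule absolutely_continuousI_density) simp
  moreover have "integrable Q X" "(\<integral>\<omega>. X \<omega> \<partial>Q) \<le> 0" if "X \<in> K_adm P F T S" for X
  proof -
    have X: "X \<in> borel_measurable P" using that by (simp add: K_adm_def L0_def)
    show "integrable Q X"
      unfolding Q_def using K_int[OF that] q X by (subst integrable_real_density) (auto simp: mult.commute)
    show "(\<integral>\<omega>. X \<omega> \<partial>Q) \<le> 0"
      unfolding Q_def using K_le[OF that] q X by (subst integral_real_density) (auto simp: mult.commute)
  qed
  moreover have "(\<integral>\<^sup>+\<omega>. e2ennreal (pos_part \<Phi> (density_of P Q \<omega>)) \<partial>P) < \<infinity>"
  proof -
    have "(\<integral>\<^sup>+\<omega>. e2ennreal (pos_part \<Phi> (density_of P Q \<omega>)) \<partial>P) = (\<integral>\<^sup>+\<omega>. e2ennreal (pos_part \<Phi> (q \<omega>)) \<partial>P)"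
      using dens by (intro nn_integral_cong_AE) auto
    with fin show ?thesis by simp
  qed
  ultimately have "Q \<in> M_Phi P F T S \<Phi>"
    by (auto simp: M_Phi_def M1_adm_def L1_def K_adm_def)
  with dens show ?thesis using that by blast
qed

lemma M_Phi_midpoint:
  assumes P: "prob_space P" and \<Phi>: "penalty_function \<Phi>"
    and Q: "Q \<in> M_Phi P F T S \<Phi>" and R: "R \<in> M_Phi P F T S \<Phi>"
  obtains M where "M \<in> M_Phi P F T S \<Phi>"
    "AE \<omega> in P. density_of P M \<omega> = (density_of P Q \<omega> + density_of P R \<omega>) / 2"
proof -
  note Qd = M_Phi_density_of[OF P Q] and Rd = M_Phi_density_of[OF P R]
  let ?q = "density_of P Q" and ?r = "density_of P R"
  show ?thesis
  proof (rule M_Phi_ex_density[OF P, of "\<lambda>\<omega>. (?q \<omega> + ?r \<omega>) / 2" F T S \<Phi>])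
    fix X assume X: "X \<in> K_adm P F T S"
    then have Xm: "X \<in> borel_measurable P" by (simp add: K_adm_def L0_def)
    have "integrable Q X" "integrable R X"
      using M_PhiD(4)[OF Q] M_PhiD(4)[OF R] X by (auto simp: L1_def)
    then have i: "integrable P (\<lambda>\<omega>. X \<omega> * ?q \<omega>)" "integrable P (\<lambda>\<omega>. X \<omega> * ?r \<omega>)"
      using Qd(1) Rd(1) Xm by auto
    have eq: "(\<lambda>\<omega>. X \<omega> * ((?q \<omega> + ?r \<omega>) / 2)) = (\<lambda>\<omega>. (X \<omega> * ?q \<omega> + X \<omega> * ?r \<omega>) / 2)"
      by (simp add: fun_eq_iff algebra_simps)
    show "integrable P (\<lambda>\<omega>. X \<omega> * ((?q \<omega> + ?r \<omega>) / 2))"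
      unfolding eq using i by auto
    have "(\<integral>\<omega>. (X \<omega> * ?q \<omega> + X \<omega> * ?r \<omega>) / 2 \<partial>P) = ((\<integral>\<omega>. X \<omega> \<partial>Q) + (\<integral>\<omega>. X \<omega> \<partial>R)) / 2"
      using i Qd(2) Rd(2) Xm by simp
    then show "(\<integral>\<omega>. X \<omega> * ((?q \<omega> + ?r \<omega>) / 2) \<partial>P) \<le> 0"
      unfolding eq using M_PhiD(5)[OF Q X] M_PhiD(5)[OF R X] by simp
  next
    have "(\<integral>\<^sup>+\<omega>. e2ennreal (pos_part \<Phi> ((?q \<omega> + ?r \<omega>) / 2)) \<partial>P) \<le>
        (\<integral>\<^sup>+\<omega>. e2ennreal (pos_part \<Phi> (?q \<omega>)) + e2ennreal (pos_part \<Phi> (?r \<omega>)) \<partial>P)"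
      by (intro nn_integral_mono penalty_function_midpoint[OF \<Phi>]) auto
    also have "\<dots> < \<infinity>"
      using M_PhiD(6)[OF Q] M_PhiD(6)[OF R]
      by (subst nn_integral_add) (auto intro: penalty_function_measurable[OF \<Phi>])
    finally show "(\<integral>\<^sup>+\<omega>. e2ennreal (pos_part \<Phi> ((?q \<omega> + ?r \<omega>) / 2)) \<partial>P) < \<infinity>" .
  qed (use Qd(3,4) Rd(3,4) that in auto)
qed

text \<open>The mixture is built by successive midpoints. Each midpoint of \<open>Q\<close> and
  \<open>R\<close> loses a factor 2, and \<open>2 * c + 2\<close> is large enough both for the
  earlier measures, bounded by \<open>c\<close> times \<open>Q\<close>, and for \<open>R\<close>
  itself.\<close>

lemma M_Phi_dominating:
  assumes P: "prob_space P" and \<Phi>: "penalty_function \<Phi>"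
    and A: "finite A" "A \<noteq> {}" "A \<subseteq> M_Phi P F T S \<Phi>"
  shows "\<exists>Q\<in>M_Phi P F T S \<Phi>. \<exists>c\<ge>0. \<forall>R\<in>A. AE \<omega> in P. density_of P R \<omega> \<le> c * density_of P Q \<omega>"
  using A
proof (induction rule: finite_ne_induct)
  case (singleton R)
  then show ?case by (intro bexI[of _ R] exI[of _ 1]) auto
next
  case (insert R A)
  then obtain Q c where Q: "Q \<in> M_Phi P F T S \<Phi>" "c \<ge> 0"
    "\<And>R. R \<in> A \<Longrightarrow> AE \<omega> in P. density_of P R \<omega> \<le> c * density_of P Q \<omega>"
    by auto
  obtain M where M: "M \<in> M_Phi P F T S \<Phi>"
    "AE \<omega> in P. density_of P M \<omega> = (density_of P Q \<omega> + density_of P R \<omega>) / 2"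
    using M_Phi_midpoint[OF P \<Phi> Q(1)] insert by blast
  have "AE \<omega> in P. density_of P R' \<omega> \<le> (2 * c + 2) * density_of P M \<omega>" if "R' \<in> insert R A" for R'
  proof (cases "R' = R")
    case True
    from M(2) show ?thesis
    proof eventually_elim
      case (elim \<omega>)
      have "0 \<le> c * density_of P R \<omega>" "0 \<le> c * density_of P Q \<omega>" using Q(2) by simp_all
      then show ?case using True elim by (simp add: algebra_simps)
    qed
  next
    case False
    with that have "AE \<omega> in P. density_of P R' \<omega> \<le> c * density_of P Q \<omega>" using Q(3) by blast
    with M(2) show ?thesis
    proof eventually_elim
      case (elim \<omega>)
      have "(2 * c + 2) * density_of P M \<omega> = c * density_of P Q \<omega> +
          (c * density_of P R \<omega> + density_of P Q \<omega> + density_of P R \<omega>)"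
        using elim by (simp add: algebra_simps)
      moreover have "0 \<le> c * density_of P R \<omega> + density_of P Q \<omega> + density_of P R \<omega>"
        using Q(2) by simp
      ultimately show ?case using elim by linarith
    qed
  qed
  then show ?case using M(1) Q(2) by (intro bexI[of _ M] exI[of _ "2 * c + 2"]) auto
qed

text \<open>The constants of the growth condition are uniform over \<open>{l0..l1}\<close>, so the
  bound applies pointwise with the random factor \<open>Y \<omega>\<close>; its linear term is
  integrable because the density is.\<close>

lemma M_Phi_growth:
  assumes P: "prob_space P" and \<Phi>: "penalty_function \<Phi>" "growth_condition \<Phi>"
    and Q: "Q \<in> M_Phi P F T S \<Phi>"
    and Y: "Y \<in> borel_measurable P" "0 < l0" "\<And>\<omega>. l0 \<le> Y \<omega>" "\<And>\<omega>. Y \<omega> \<le> l1"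
  shows "(\<integral>\<^sup>+\<omega>. e2ennreal (pos_part \<Phi> (Y \<omega> * density_of P Q \<omega>)) \<partial>P) < \<infinity>"
proof -
  interpret P: prob_space P by fact
  obtain \<alpha> \<beta> where ab: "0 \<le> \<alpha>" "0 \<le> \<beta>"
    "\<And>l y. l0 \<le> l \<Longrightarrow> l \<le> l1 \<Longrightarrow> 0 \<le> y \<Longrightarrow> e2ennreal (pos_part \<Phi> (l * y)) \<le>
      ennreal (\<alpha> + 1) * e2ennreal (pos_part \<Phi> y) + ennreal (\<beta> * (y + 1))"
    using growth_condition_bound[OF \<Phi>(2) Y(2)] by metis
  let ?q = "density_of P Q"
  have int: "integrable P (\<lambda>\<omega>. \<beta> * (?q \<omega> + 1))"
    using M_Phi_density_of(3)[OF P Q] by auto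
  have meas [measurable]: "(\<lambda>\<omega>. e2ennreal (pos_part \<Phi> (?q \<omega>))) \<in> borel_measurable P"
    by (intro penalty_function_measurable[OF \<Phi>(1)]) auto
  have "(\<integral>\<^sup>+\<omega>. e2ennreal (pos_part \<Phi> (Y \<omega> * ?q \<omega>)) \<partial>P) \<le>
      (\<integral>\<^sup>+\<omega>. ennreal (\<alpha> + 1) * e2ennreal (pos_part \<Phi> (?q \<omega>)) + ennreal (\<beta> * (?q \<omega> + 1)) \<partial>P)"
    using Y by (intro nn_integral_mono ab) auto
  also have "\<dots> = ennreal (\<alpha> + 1) * (\<integral>\<^sup>+\<omega>. e2ennreal (pos_part \<Phi> (?q \<omega>)) \<partial>P) +
      (\<integral>\<^sup>+\<omega>. ennreal (\<beta> * (?q \<omega> + 1)) \<partial>P)"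
    by (subst nn_integral_add) (auto intro!: nn_integral_cmult)
  also have "\<dots> < \<infinity>"
    using M_PhiD(6)[OF Q] ab int
    by (auto simp: nn_integral_eq_integral ennreal_mult_less_top)
  finally show ?thesis .
qed


section \<open>Bounded claims and the weak topology\<close>

text \<open>A basic open box of a product topology restricts only finitely many coordinates, so
  closure reduces to finitely many pairings. \<open>C \<inter> E\<close> appears because open sets
  lie inside the carrier \<open>E\<close>.\<close>

lemma weak_topology_closure_iff:
  "X \<in> weak_topology P E G closure_of C \<longleftrightarrow>
     X \<in> E \<and> (\<forall>I W. finite I \<longrightarrow> I \<subseteq> G \<longrightarrow>
       (\<forall>w\<in>I. open (W w) \<and> (\<integral>\<omega>. X \<omega> * w \<omega> \<partial>P) \<in> W w) \<longrightarrow>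
       (\<exists>Z\<in>C \<inter> E. \<forall>w\<in>I. (\<integral>\<omega>. Z \<omega> * w \<omega> \<partial>P) \<in> W w))"
    (is "?L \<longleftrightarrow> ?R")
proof -
  let ?f = "\<lambda>z. \<lambda>w\<in>G. \<integral>\<omega>. z \<omega> * w \<omega> \<partial>P"
  let ?p = "product_topology (\<lambda>_. euclideanreal) G"
  have f_top: "?f z \<in> PiE G W \<longleftrightarrow> (\<forall>w\<in>G. (\<integral>\<omega>. z \<omega> * w \<omega> \<partial>P) \<in> W w)" for z and W :: "_ \<Rightarrow> real set"
    by (auto simp: PiE_iff)
  have top: "topspace (weak_topology P E G) = E"
    unfolding weak_topology_def topspace_pullback_topology by (auto simp: PiE_iff)
  show ?thesis
  proof
    assume L: ?L
    show ?R
    proof (intro conjI allI impI)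
      show "X \<in> E" using L top closure_of_subset_topspace[of "weak_topology P E G" C] by auto
      fix I W assume I: "finite I" "I \<subseteq> G"
        and W: "\<forall>w\<in>I. open (W w) \<and> (\<integral>\<omega>. X \<omega> * w \<omega> \<partial>P) \<in> W w"
      \<comment> \<open>The coordinates outside \<open>I\<close> stay unrestricted, which completes
        the given sets to an open box.\<close>
      define W' where "W' w = (if w \<in> I then W w else UNIV)" for w
      have "openin ?p (PiE G W')"
        unfolding openin_PiE_gen
        by (intro disjI2 conjI ballI finite_subset[OF _ I(1)]) (use W in \<open>auto simp: W'_def split: if_splits\<close>)
      then have op: "openin (weak_topology P E G) (?f -` PiE G W' \<inter> E)"
        unfolding weak_topology_def openin_pullback_topology by blast
      have X: "X \<in> ?f -` PiE G W' \<inter> E"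
        using \<open>X \<in> E\<close> W by (auto simp: f_top W'_def)
      obtain Z where Z: "Z \<in> C" "Z \<in> E" "?f Z \<in> PiE G W'"
        using L[unfolded in_closure_of, THEN conjunct2, rule_format, OF conjI[OF X op]] by auto
      have "(\<integral>\<omega>. Z \<omega> * w \<omega> \<partial>P) \<in> W w" if "w \<in> I" for w
      proof -
        have "w \<in> G" using that I(2) by blast
        with Z(3)[unfolded f_top] have "(\<integral>\<omega>. Z \<omega> * w \<omega> \<partial>P) \<in> W' w" by blast
        with that show ?thesis by (simp add: W'_def)
      qed
      with Z show "\<exists>Z\<in>C \<inter> E. \<forall>w\<in>I. (\<integral>\<omega>. Z \<omega> * w \<omega> \<partial>P) \<in> W w"
        by blast
    qed
  next
    assume R: ?R
    show ?L
      unfolding in_closure_of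
    proof (intro conjI allI impI)
      show "X \<in> topspace (weak_topology P E G)" using R top by simp
      fix U assume U: "X \<in> U \<and> openin (weak_topology P E G) U"
      then obtain V where V: "openin ?p V" "U = ?f -` V \<inter> E"
        unfolding weak_topology_def openin_pullback_topology by blast
      with U have "?f X \<in> V" by simp
      from bspec[OF V(1)[unfolded openin_product_topology_alt] this]
      obtain W where W: "finite {w\<in>G. W w \<noteq> topspace euclideanreal}"
        "\<forall>w\<in>G. openin euclideanreal (W w)" "?f X \<in> PiE G W" "PiE G W \<subseteq> V"
        by (elim exE conjE) (rule that)
      define I where "I = {w\<in>G. W w \<noteq> UNIV}"
      have "\<exists>Z\<in>C \<inter> E. \<forall>w\<in>I. (\<integral>\<omega>. Z \<omega> * w \<omega> \<partial>P) \<in> W w"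
      proof (rule conjunct2[OF R, rule_format])
        show "finite I" "I \<subseteq> G" using W(1) by (auto simp: I_def)
        show "open (W w) \<and> (\<integral>\<omega>. X \<omega> * w \<omega> \<partial>P) \<in> W w" if "w \<in> I" for w
          using that W(2,3) unfolding f_top by (auto simp: I_def)
      qed
      then obtain Z where Z: "Z \<in> C" "Z \<in> E" "\<forall>w\<in>I. (\<integral>\<omega>. Z \<omega> * w \<omega> \<partial>P) \<in> W w"
        by blast
      have "?f Z \<in> PiE G W"
        unfolding f_top
      proof
        fix w assume "w \<in> G"
        then show "(\<integral>\<omega>. Z \<omega> * w \<omega> \<partial>P) \<in> W w"
          using Z(3) by (cases "w \<in> I") (auto simp: I_def)
      qed
      with W(4) V(2) Z show "\<exists>y. y \<in> C \<and> y \<in> U" by blast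
    qed
  qed
qed

lemma F_Phi_dominated:
  assumes P: "prob_space P" and \<Phi>: "penalty_function \<Phi>" and ne: "M_Phi P F T S \<Phi> \<noteq> {}"
    and I: "finite I" "I \<subseteq> F_Phi P F T S \<Phi>"
  obtains Q where "Q \<in> M_Phi P F T S \<Phi>"
    "\<And>w. w \<in> I \<Longrightarrow> \<exists>c\<ge>0. AE \<omega> in P. \<bar>w \<omega>\<bar> \<le> c * density_of P Q \<omega>"
proof -
  obtain Q0 where Q0: "Q0 \<in> M_Phi P F T S \<Phi>" using ne by blast
  \<comment> \<open>One predicate for the span representation lets number, coefficients and measures
    be chosen simultaneously for all \<open>w\<close>.\<close>
  define D where "D w n a R \<longleftrightarrow> (\<forall>i<n. R i \<in> M_Phi P F T S \<Phi>) \<and>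
      (AE \<omega> in P. w \<omega> = (\<Sum>i<n. a i * density_of P (R i) \<omega>))"
    for w :: "'a \<Rightarrow> real" and n :: nat and a R
  have "\<forall>w\<in>I. \<exists>n a R. D w n a R"
    using I(2) unfolding F_Phi_def D_def by blast
  then obtain n a R where D: "\<And>w. w \<in> I \<Longrightarrow> D w (n w) (a w) (R w)"
    by metis
  have R: "R w i \<in> M_Phi P F T S \<Phi>" if "w \<in> I" "i < n w" for w i
    using D[OF that(1)] that(2) by (simp add: D_def)
  have w_eq: "AE \<omega> in P. w \<omega> = (\<Sum>i<n w. a w i * density_of P (R w i) \<omega>)" if "w \<in> I" for w
    using D[OF that] by (simp add: D_def)
  \<comment> \<open>\<open>Q0\<close> keeps the family nonempty when \<open>I\<close> is empty or
    all representations are empty sums.\<close>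
  let ?A = "insert Q0 (\<Union>w\<in>I. R w ` {..<n w})"
  have "finite ?A" "?A \<noteq> {}" "?A \<subseteq> M_Phi P F T S \<Phi>"
    using I R Q0 by auto
  from M_Phi_dominating[OF P \<Phi> this] obtain Q c where Q: "Q \<in> M_Phi P F T S \<Phi>" "c \<ge> 0"
    "\<And>R. R \<in> ?A \<Longrightarrow> AE \<omega> in P. density_of P R \<omega> \<le> c * density_of P Q \<omega>"
    by metis
  have "AE \<omega> in P. \<bar>w \<omega>\<bar> \<le> (\<Sum>i<n w. \<bar>a w i\<bar>) * c * density_of P Q \<omega>" if w: "w \<in> I" for w
  proof -
    have "AE \<omega> in P. \<forall>i\<in>{..<n w}. density_of P (R w i) \<omega> \<le> c * density_of P Q \<omega>"
      using Q(3) w by (intro AE_finite_allI) auto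
    with w_eq[OF w] show ?thesis
    proof eventually_elim
      case (elim \<omega>)
      have "\<bar>w \<omega>\<bar> \<le> (\<Sum>i<n w. \<bar>a w i * density_of P (R w i) \<omega>\<bar>)"
        unfolding elim(1) by (rule sum_abs)
      also have "\<dots> \<le> (\<Sum>i<n w. \<bar>a w i\<bar> * (c * density_of P Q \<omega>))"
        using elim(2) by (intro sum_mono) (auto simp: abs_mult intro!: mult_left_mono)
      also have "\<dots> = (\<Sum>i<n w. \<bar>a w i\<bar>) * c * density_of P Q \<omega>"
        by (simp add: sum_distrib_right mult.assoc)
      finally show ?case .
    qed
  qed
  moreover have "0 \<le> (\<Sum>i<n w. \<bar>a w i\<bar>) * c" for w
    using Q(2) by (intro mult_nonneg_nonneg sum_nonneg) auto
  ultimately show ?thesis using that Q(1) by blast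
qed

text \<open>Once \<open>w\<close> is dominated by a multiple of the density of \<open>Q\<close>, its
  weak coordinate is Lipschitz in the L1(Q)-norm; thus L1(Q)-approximation becomes weak
  approximation.\<close>

lemma dominated_pairing:
  assumes P: "prob_space P" and Q: "Q \<in> M_Phi P F T S \<Phi>" and z: "z \<in> L1 P Q"
    and w: "w \<in> borel_measurable P" "AE \<omega> in P. \<bar>w \<omega>\<bar> \<le> c * density_of P Q \<omega>" "0 \<le> c"
  shows "integrable P (\<lambda>\<omega>. z \<omega> * w \<omega>)"
    and "\<bar>\<integral>\<omega>. z \<omega> * w \<omega> \<partial>P\<bar> \<le> c * (\<integral>\<omega>. \<bar>z \<omega>\<bar> \<partial>Q)"
proof -
  note Qd = M_Phi_density_of[OF P Q]
  have zm [measurable]: "z \<in> borel_measurable P" and zi: "integrable Q z"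
    using z by (auto simp: L1_def L0_def)
  note w(1)[measurable]
  have i: "integrable P (\<lambda>\<omega>. c * (\<bar>z \<omega>\<bar> * density_of P Q \<omega>))"
    using Qd(1)[of "\<lambda>\<omega>. \<bar>z \<omega>\<bar>"] zi by auto
  have le: "AE \<omega> in P. \<bar>z \<omega> * w \<omega>\<bar> \<le> c * (\<bar>z \<omega>\<bar> * density_of P Q \<omega>)"
    using w(2)
  proof eventually_elim
    case (elim \<omega>)
    then show ?case
      using mult_left_mono[OF elim, of "\<bar>z \<omega>\<bar>"] by (simp add: abs_mult mult_ac)
  qed
  show zw: "integrable P (\<lambda>\<omega>. z \<omega> * w \<omega>)"
    by (rule Bochner_Integration.integrable_bound[OF i])
      (use le w(3) in \<open>auto simp: abs_mult elim!: eventually_mono\<close>)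
  have "\<bar>\<integral>\<omega>. z \<omega> * w \<omega> \<partial>P\<bar> \<le> (\<integral>\<omega>. \<bar>z \<omega> * w \<omega>\<bar> \<partial>P)"
    by (rule integral_abs_bound)
  also have "\<dots> \<le> (\<integral>\<omega>. c * (\<bar>z \<omega>\<bar> * density_of P Q \<omega>) \<partial>P)"
    by (intro integral_mono_AE i integrable_abs zw le)
  also have "\<dots> = c * (\<integral>\<omega>. \<bar>z \<omega>\<bar> \<partial>Q)"
    using Qd(2)[of "\<lambda>\<omega>. \<bar>z \<omega>\<bar>"] by simp
  finally show "\<bar>\<integral>\<omega>. z \<omega> * w \<omega> \<partial>P\<bar> \<le> c * (\<integral>\<omega>. \<bar>z \<omega>\<bar> \<partial>Q)" .
qed

lemma density_of_in_F_Phi: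
  assumes P: "prob_space P" and Q: "Q \<in> M_Phi P F T S \<Phi>"
  shows "density_of P Q \<in> F_Phi P F T S \<Phi>"
proof -
  have "density_of P Q \<in> L1 P P"
    using M_Phi_density_of(3)[OF P Q] by (simp add: L1_def L0_def)
  then show ?thesis
    unfolding F_Phi_def mem_Collect_eq using Q
    by (intro conjI exI[where x = "Suc 0"] exI[where x = "\<lambda>i. 1"] exI[where x = "\<lambda>i. Q"]) simp_all
qed

lemma C_adm_subset_L1:
  assumes P: "prob_space P" and Q: "Q \<in> M_Phi P F T S \<Phi>"
  shows "C_adm P F T S \<subseteq> L1 P Q"
proof
  fix Z assume Z: "Z \<in> C_adm P F T S"
  interpret Q: prob_space Q using M_PhiD(1)[OF Q] .
  from Z obtain c where Zm: "Z \<in> borel_measurable P" and c: "AE \<omega> in P. \<bar>Z \<omega>\<bar> \<le> c"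
    by (auto simp: C_adm_def L_infty_def L0_def)
  have "Z \<in> borel_measurable Q"
    using Zm M_PhiD(2)[OF Q] by (simp cong: measurable_cong_sets)
  moreover have "AE \<omega> in Q. norm (Z \<omega>) \<le> c"
    using M_Phi_density_of(5)[OF P Q c] by simp
  ultimately have "integrable Q Z"
    by (intro Q.integrable_const_bound)
  with Zm show "Z \<in> L1 P Q" by (simp add: L1_def L0_def)
qed

lemma rv_diffI: "X \<in> A \<Longrightarrow> Y \<in> B \<Longrightarrow> (\<lambda>\<omega>. X \<omega> - Y \<omega>) \<in> rv_diff A B"
  unfolding rv_diff_def by blast

lemma C_adm_dense:
  assumes P: "prob_space P" and T: "0 \<le> T" and Q: "Q \<in> M_Phi P F T S \<Phi>"
    and X: "X \<in> rv_diff (K_adm P F T S) (L1_plus P Q)" and e: "e > 0"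
  shows "\<exists>Z\<in>C_adm P F T S. (\<integral>\<omega>. \<bar>X \<omega> - Z \<omega>\<bar> \<partial>Q) < e"
proof -
  have [measurable_cong]: "sets Q = sets P" using M_PhiD(2)[OF Q] .
  obtain k l where X_eq: "X = (\<lambda>\<omega>. k \<omega> - l \<omega>)" and k: "k \<in> K_adm P F T S" and l: "l \<in> L1_plus P Q"
    using X by (auto simp: rv_diff_def)
  have km [measurable]: "k \<in> borel_measurable P" using k by (simp add: K_adm_def L0_def)
  have lm [measurable]: "l \<in> borel_measurable P" and l0: "AE \<omega> in P. 0 \<le> l \<omega>"
    using l by (auto simp: L1_plus_def L0_plus_def L0_def)
  have ki: "integrable Q k" and li: "integrable Q l"
    using k l M_PhiD(4)[OF Q] by (auto simp: L1_plus_def L1_def)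
  obtain c where c: "c \<ge> 0" "AE \<omega> in P. - c \<le> k \<omega>"
    using K_adm_bounded_below[OF k T] by blast
  \<comment> \<open>Both parts are capped at \<open>n\<close> from above; as
    \<open>k \<ge> - c\<close> and \<open>l \<ge> 0\<close> almost surely, this bounds the
    difference.\<close>
  define Z where "Z n \<omega> = min (k \<omega>) (real n) - min (l \<omega>) (real n)" for n \<omega>
  have "Z n \<in> C_adm P F T S" for n
  proof -
    \<comment> \<open>\<open>Z n\<close> is \<open>k\<close> minus the sum of what the cap removes
      from \<open>k\<close> and the capped \<open>l\<close>, both nonnegative.\<close>
    have "(\<lambda>\<omega>. k \<omega> - min (k \<omega>) (real n) + min (l \<omega>) (real n)) \<in> L0_plus P"
      using l0 unfolding L0_plus_def L0_def by (auto elim!: eventually_mono)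
    from rv_diffI[OF k this] have "Z n \<in> rv_diff (K_adm P F T S) (L0_plus P)"
      by (simp add: Z_def[abs_def])
    moreover have "AE \<omega> in P. \<bar>Z n \<omega>\<bar> \<le> c + 2 * real n"
      using l0 c(2) by eventually_elim (use c(1) in \<open>auto simp: Z_def\<close>)
    then have "Z n \<in> L_infty P"
      unfolding L_infty_def L0_def by (auto simp: Z_def[abs_def])
    ultimately show ?thesis by (simp add: C_adm_def)
  qed
  moreover have "(\<lambda>n. \<integral>\<omega>. \<bar>X \<omega> - Z n \<omega>\<bar> \<partial>Q) \<longlonglongrightarrow> (\<integral>\<omega>. 0 \<partial>Q)"
  proof (rule integral_dominated_convergence[where w = "\<lambda>\<omega>. \<bar>k \<omega>\<bar> + \<bar>l \<omega>\<bar>"])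
    show "AE \<omega> in Q. (\<lambda>n. \<bar>X \<omega> - Z n \<omega>\<bar>) \<longlonglongrightarrow> 0"
    proof (rule AE_I2)
      fix \<omega>
      obtain n0 where n0: "max (k \<omega>) (l \<omega>) \<le> real n0" using real_arch_simple by blast
      have "\<forall>\<^sub>F n in sequentially. 0 = \<bar>X \<omega> - Z n \<omega>\<bar>"
        using eventually_ge_at_top[of n0]
      proof eventually_elim
        case (elim n)
        then have "k \<omega> \<le> real n" "l \<omega> \<le> real n" using n0 by auto
        then show ?case by (simp add: X_eq Z_def)
      qed
      then show "(\<lambda>n. \<bar>X \<omega> - Z n \<omega>\<bar>) \<longlonglongrightarrow> 0"
        by (rule Lim_transform_eventually[OF tendsto_const])
    qed
    show "AE \<omega> in Q. norm \<bar>X \<omega> - Z n \<omega>\<bar> \<le> \<bar>k \<omega>\<bar> + \<bar>l \<omega>\<bar>" for n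
      by (auto simp: X_eq Z_def)
    show "integrable Q (\<lambda>\<omega>. \<bar>k \<omega>\<bar> + \<bar>l \<omega>\<bar>)" using ki li by auto
    show "(\<lambda>\<omega>. \<bar>X \<omega> - Z n \<omega>\<bar>) \<in> borel_measurable Q" for n
      unfolding X_eq Z_def by measurable
  qed simp
  then have "\<forall>\<^sub>F n in sequentially. (\<integral>\<omega>. \<bar>X \<omega> - Z n \<omega>\<bar> \<partial>Q) < e"
    using e by (intro order_tendstoD) simp_all
  ultimately show ?thesis
    using eventually_happens'[OF sequentially_bot] by blast
qed

text \<open>If the distance were 0, elements at distance below \<open>1 / (n + 1)\<close> would form
  a sequence that puts \<open>X\<close> into the closure.\<close>

lemma not_L1_closureD:
  assumes "X \<in> L1 P Q" "X \<notin> L1_closure P Q A"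
  shows "\<exists>e>0. \<forall>Z\<in>A. e \<le> (\<integral>\<omega>. \<bar>X \<omega> - Z \<omega>\<bar> \<partial>Q)"
proof (rule ccontr)
  assume neg: "\<not> ?thesis"
  have "\<exists>Z\<in>A. (\<integral>\<omega>. \<bar>X \<omega> - Z \<omega>\<bar> \<partial>Q) < inverse (real (Suc n))" for n
    using neg by (metis inverse_positive_iff_positive not_le of_nat_0_less_iff zero_less_Suc)
  then obtain Z where Z: "\<And>n. Z n \<in> A" "\<And>n. (\<integral>\<omega>. \<bar>X \<omega> - Z n \<omega>\<bar> \<partial>Q) < inverse (real (Suc n))"
    by metis
  have "\<forall>\<^sub>F n in sequentially. norm (\<integral>\<omega>. \<bar>X \<omega> - Z n \<omega>\<bar> \<partial>Q) \<le> inverse (real (Suc n))"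
    using Z(2) by (auto simp: less_imp_le simp del: of_nat_Suc)
  then have "(\<lambda>n. \<integral>\<omega>. \<bar>X \<omega> - Z n \<omega>\<bar> \<partial>Q) \<longlonglongrightarrow> 0"
    by (rule Lim_null_comparison) (rule LIMSEQ_inverse_real_of_nat)
  with assms Z(1) show False
    unfolding L1_closure_def by blast
qed

section \<open>Separation by a pricing measure and the two inclusions\<close>

lemma separating_measure:
  fixes S :: "real \<Rightarrow> 'a \<Rightarrow> real ^ 'd"
  assumes U: "usual_conditions P F T" "0 \<le> T" and S: "adapted_cadlag P F T S"
    and \<Phi>: "penalty_function \<Phi>" "growth_condition \<Phi>"
    and Q: "Q \<in> M_Phi P F T S \<Phi>" and X: "X \<in> L1 P Q"
    and nX: "X \<notin> L1_closure P Q (rv_diff (K_adm P F T S) (L1_plus P Q))"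
  obtains R where "R \<in> M_Phi P F T S \<Phi>" "0 < (\<integral>\<omega>. X \<omega> * density_of P R \<omega> \<partial>P)"
proof -
  have P: "prob_space P" using U by (simp add: usual_conditions_def)
  interpret Q: prob_space Q using M_PhiD(1)[OF Q] .
  note Qd = M_Phi_density_of[OF P Q]
  have sets_Q [measurable_cong]: "sets Q = sets P" using M_PhiD(2)[OF Q] .
  let ?K = "K_adm P F T S" and ?q = "density_of P Q"
  let ?G = "rv_diff ?K (L1_plus P Q)"
  have K_L1: "k \<in> L1 P Q" if "k \<in> ?K" for k
    using that M_PhiD(4)[OF Q] by blast
  have Xm [measurable]: "X \<in> borel_measurable P" and Xi: "integrable Q X"
    using X by (auto simp: L1_def L0_def)
  obtain e where e: "e > 0" "\<And>Z. Z \<in> ?G \<Longrightarrow> e \<le> (\<integral>\<omega>. \<bar>X \<omega> - Z \<omega>\<bar> \<partial>Q)"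
    using not_L1_closureD[OF X nX] by blast
  obtain Y where Y: "Y \<in> borel_measurable Q" "\<And>\<omega>. 0 \<le> Y \<omega>" "\<And>\<omega>. Y \<omega> \<le> 1"
    "\<And>Z. Z \<in> ?G \<Longrightarrow> (\<integral>\<omega>. Y \<omega> * Z \<omega> \<partial>Q) \<le> 0" "0 < (\<integral>\<omega>. Y \<omega> * X \<omega> \<partial>Q)"
  proof (rule L1_cone_separation[OF Q.finite_measure_axioms _ _ _ _ Xi e])
    fix Z assume "Z \<in> ?G"
    then show "integrable Q Z"
      using K_L1 by (auto simp: rv_diff_def L1_plus_def L1_def)
  next
    fix Z Z' assume "Z \<in> ?G" "Z' \<in> ?G"
    then obtain k l k' l' where k: "k \<in> ?K" "k' \<in> ?K" and l: "l \<in> L1_plus P Q" "l' \<in> L1_plus P Q"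
      and Z: "Z = (\<lambda>\<omega>. k \<omega> - l \<omega>)" "Z' = (\<lambda>\<omega>. k' \<omega> - l' \<omega>)"
      by (auto simp: rv_diff_def)
    have "(\<lambda>\<omega>. l \<omega> + l' \<omega>) \<in> L1_plus P Q"
      using l by (auto simp: L1_plus_def L1_def L0_plus_def L0_def)
    from rv_diffI[OF K_adm_add[OF U S k] this]
    show "(\<lambda>\<omega>. Z \<omega> + Z' \<omega>) \<in> ?G"
      by (simp add: Z algebra_simps)
  next
    fix Z and c :: real assume "Z \<in> ?G" and c: "c \<ge> 0"
    then obtain k l where k: "k \<in> ?K" and l: "l \<in> L1_plus P Q" and Z: "Z = (\<lambda>\<omega>. k \<omega> - l \<omega>)"
      by (auto simp: rv_diff_def)
    have "(\<lambda>\<omega>. c * l \<omega>) \<in> L1_plus P Q"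
      using l c by (auto simp: L1_plus_def L1_def L0_plus_def L0_def elim!: eventually_mono)
    from rv_diffI[OF K_adm_scale[OF U S k c] this]
    show "(\<lambda>\<omega>. c * Z \<omega>) \<in> ?G"
      by (simp add: Z algebra_simps)
  next
    fix A assume "A \<in> sets Q"
    then have "indicator A \<in> L1_plus P Q"
      by (auto simp: L1_plus_def L1_def L0_plus_def L0_def sets_Q Q.emeasure_eq_measure)
    from rv_diffI[OF K_adm_zero[OF U(2)] this]
    show "(\<lambda>\<omega>. - indicator A \<omega>) \<in> ?G" by simp
  qed (assumption, rule that)
  have Ym [measurable]: "Y \<in> borel_measurable P"
    using Y(1) by (simp add: measurable_cong_sets[OF sets_Q refl])
  \<comment> \<open>Small enough that \<open>\<delta>\<close> times a possibly negative expectation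
    of \<open>X\<close> costs at most half of the gain from \<open>Y\<close>; the added 1 avoids
    division by 0.\<close>
  define \<delta> where "\<delta> = (\<integral>\<omega>. Y \<omega> * X \<omega> \<partial>Q) / (2 * (\<bar>\<integral>\<omega>. X \<omega> \<partial>Q\<bar> + 1))"
  have \<delta>: "\<delta> > 0" using Y(5) by (simp add: \<delta>_def)
  have "\<delta> * (\<bar>\<integral>\<omega>. X \<omega> \<partial>Q\<bar> + 1) = (\<integral>\<omega>. Y \<omega> * X \<omega> \<partial>Q) / 2"
    unfolding \<delta>_def by (simp add: field_simps)
  moreover have "\<delta> * - (\<integral>\<omega>. X \<omega> \<partial>Q) \<le> \<delta> * (\<bar>\<integral>\<omega>. X \<omega> \<partial>Q\<bar> + 1)"
    using \<delta> by (intro mult_left_mono) auto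
  ultimately have pos: "0 < (\<integral>\<omega>. Y \<omega> * X \<omega> \<partial>Q) + \<delta> * (\<integral>\<omega>. X \<omega> \<partial>Q)"
    using Y(5) by simp
  \<comment> \<open>The normalizing constant: the \<open>Q\<close>-expectation of
    \<open>Y + \<delta>\<close>.\<close>
  define m where "m = (\<integral>\<omega>. Y \<omega> \<partial>Q) + \<delta>"
  have m: "m > 0"
    using \<delta> Y(2) by (auto simp: m_def intro!: add_nonneg_pos)
  define q where "q \<omega> = (Y \<omega> + \<delta>) / m * ?q \<omega>" for \<omega>
  have pair: "integrable P (\<lambda>\<omega>. f \<omega> * q \<omega>)"
      "(\<integral>\<omega>. f \<omega> * q \<omega> \<partial>P) = ((\<integral>\<omega>. Y \<omega> * f \<omega> \<partial>Q) + \<delta> * (\<integral>\<omega>. f \<omega> \<partial>Q)) / m"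
    if fm [measurable]: "f \<in> borel_measurable P" and fi: "integrable Q f" for f
  proof -
    have Yf: "integrable Q (\<lambda>\<omega>. Y \<omega> * f \<omega>)"
      by (rule Bochner_Integration.integrable_bound[OF fi])
        (use Y(2,3) in \<open>auto simp: abs_mult intro!: AE_I2 mult_left_le_one_le\<close>)
    have eq: "f \<omega> * q \<omega> = ((Y \<omega> * f \<omega> + \<delta> * f \<omega>) / m) * ?q \<omega>" for \<omega>
      using m by (simp add: q_def field_simps)
    have i: "integrable Q (\<lambda>\<omega>. (Y \<omega> * f \<omega> + \<delta> * f \<omega>) / m)"
      using Yf fi by auto
    have me: "(\<lambda>\<omega>. (Y \<omega> * f \<omega> + \<delta> * f \<omega>) / m) \<in> borel_measurable P" by measurable
    show "integrable P (\<lambda>\<omega>. f \<omega> * q \<omega>)"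
      unfolding eq using Qd(1)[OF me] i by simp
    have "(\<integral>\<omega>. f \<omega> * q \<omega> \<partial>P) = (\<integral>\<omega>. (Y \<omega> * f \<omega> + \<delta> * f \<omega>) / m \<partial>Q)"
      unfolding eq by (rule Qd(2)[OF me, symmetric])
    also have "\<dots> = ((\<integral>\<omega>. Y \<omega> * f \<omega> \<partial>Q) + \<delta> * (\<integral>\<omega>. f \<omega> \<partial>Q)) / m"
      using Yf fi by simp
    finally show "(\<integral>\<omega>. f \<omega> * q \<omega> \<partial>P) = ((\<integral>\<omega>. Y \<omega> * f \<omega> \<partial>Q) + \<delta> * (\<integral>\<omega>. f \<omega> \<partial>Q)) / m" .
  qed
  have q0: "0 \<le> q \<omega>" for \<omega>
    using Y(2)[of \<omega>] \<delta> m by (simp add: q_def)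
  have one: "(\<lambda>\<omega>. 1::real) \<in> borel_measurable P" "integrable Q (\<lambda>\<omega>. 1::real)"
    by simp_all
  have qi: "integrable P q"
    using pair(1)[OF one] by (simp only: mult_1)
  have "(\<integral>\<omega>. Y \<omega> * 1 \<partial>Q) + \<delta> * (\<integral>\<omega>. 1 \<partial>Q) = m"
    by (simp add: m_def Q.prob_space)
  then have q1: "(\<integral>\<omega>. q \<omega> \<partial>P) = 1"
    using pair(2)[OF one] m by (simp only: mult_1) simp
  obtain R where R: "R \<in> M_Phi P F T S \<Phi>" "AE \<omega> in P. density_of P R \<omega> = q \<omega>"
  proof (rule M_Phi_ex_density[OF P qi q0 q1, of F T S \<Phi>])
    fix k assume k: "k \<in> ?K"
    then have km: "k \<in> borel_measurable P" "integrable Q k"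
      using K_L1 by (auto simp: L1_def L0_def)
    show "integrable P (\<lambda>\<omega>. k \<omega> * q \<omega>)" using pair(1)[OF km] .
    \<comment> \<open>Subtracting 0 puts \<open>k\<close> itself into the cone, so the
      \<open>Y\<close>-term is nonpositive; the \<open>\<delta>\<close>-term is nonpositive because
      \<open>Q\<close> prices \<open>k\<close>.\<close>
    have "(\<lambda>\<omega>. 0) \<in> L1_plus P Q" by (simp add: L1_plus_def L1_def L0_plus_def L0_def)
    from rv_diffI[OF k this] have "k \<in> ?G" by simp
    then have "(\<integral>\<omega>. Y \<omega> * k \<omega> \<partial>Q) \<le> 0" by (rule Y(4))
    moreover have "\<delta> * (\<integral>\<omega>. k \<omega> \<partial>Q) \<le> 0"
      using M_PhiD(5)[OF Q k] \<delta> by (simp add: mult_le_0_iff)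
    ultimately show "(\<integral>\<omega>. k \<omega> * q \<omega> \<partial>P) \<le> 0"
      unfolding pair(2)[OF km] using m by (simp add: divide_nonpos_pos)
  next
    show "(\<integral>\<^sup>+\<omega>. e2ennreal (pos_part \<Phi> (q \<omega>)) \<partial>P) < \<infinity>"
      unfolding q_def
    proof (rule M_Phi_growth[OF P \<Phi> Q])
      \<comment> \<open>The bounds \<open>0 \<le> Y\<close> and \<open>Y \<le> 1\<close> confine the
        factor to a compact interval of positive numbers, where the growth condition
        applies.\<close>
      show "0 < \<delta> / m" using \<delta> m by simp
      show "\<delta> / m \<le> (Y \<omega> + \<delta>) / m" "(Y \<omega> + \<delta>) / m \<le> (1 + \<delta>) / m" for \<omega>
        using Y(2,3)[of \<omega>] m by (simp_all add: divide_right_mono)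
    qed measurable
  qed (rule that)
  have "(\<integral>\<omega>. X \<omega> * density_of P R \<omega> \<partial>P) = (\<integral>\<omega>. X \<omega> * q \<omega> \<partial>P)"
    using R(2) pair(1)[OF Xm Xi] by (intro integral_cong_AE) auto
  also have "\<dots> > 0"
    unfolding pair(2)[OF Xm Xi] using pos m by simp
  finally show ?thesis using that R(1) by blast
qed

text \<open>\<open>l\<close> is given only as nonnegative, so instead of splitting the expectation
  the proof compares \<open>Z \<le> k\<close>, both \<open>R\<close>-integrable.\<close>

lemma C_adm_expectation_nonpos:
  assumes P: "prob_space P" and R: "R \<in> M_Phi P F T S \<Phi>" and Z: "Z \<in> C_adm P F T S"
  shows "(\<integral>\<omega>. Z \<omega> * density_of P R \<omega> \<partial>P) \<le> 0"
proof -
  note Rd = M_Phi_density_of[OF P R]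
  obtain k l where Z_eq: "Z = (\<lambda>\<omega>. k \<omega> - l \<omega>)" and k: "k \<in> K_adm P F T S" and l: "l \<in> L0_plus P"
    using Z by (auto simp: C_adm_def rv_diff_def)
  have Zi: "integrable R Z" and Zm: "Z \<in> borel_measurable P"
    using C_adm_subset_L1[OF P R] Z by (auto simp: L1_def L0_def)
  have ki: "integrable R k" using k M_PhiD(4)[OF R] by (auto simp: L1_def)
  have "AE \<omega> in R. Z \<omega> \<le> k \<omega>"
    using Rd(5)[of "\<lambda>\<omega>. Z \<omega> \<le> k \<omega>"] l by (auto simp: Z_eq L0_plus_def)
  then have "(\<integral>\<omega>. Z \<omega> \<partial>R) \<le> (\<integral>\<omega>. k \<omega> \<partial>R)"
    by (intro integral_mono_AE Zi ki)
  also have "\<dots> \<le> 0" using M_PhiD(5)[OF R k] .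
  finally show ?thesis using Rd(2)[OF Zm] by simp
qed

lemma weak_closure_C_adm_subset:
  fixes S :: "real \<Rightarrow> 'a \<Rightarrow> real ^ 'd"
  assumes U: "usual_conditions P F T" "0 \<le> T" and S: "adapted_cadlag P F T S"
    and \<Phi>: "penalty_function \<Phi>" "growth_condition \<Phi>"
  shows "weak_topology P (E_Phi P F T S \<Phi>) (F_Phi P F T S \<Phi>) closure_of C_adm P F T S
    \<subseteq> C_Phi P F T S \<Phi>"
proof
  have P: "prob_space P" using U by (simp add: usual_conditions_def)
  fix X assume X: "X \<in> weak_topology P (E_Phi P F T S \<Phi>) (F_Phi P F T S \<Phi>) closure_of C_adm P F T S"
  have XE: "X \<in> E_Phi P F T S \<Phi>"
    using X unfolding weak_topology_closure_iff by blast
  show "X \<in> C_Phi P F T S \<Phi>"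
    unfolding C_Phi_def
  proof (rule INT_I, rule ccontr)
    fix Q assume Q: "Q \<in> M_Phi P F T S \<Phi>"
      and nX: "X \<notin> L1_closure P Q (rv_diff (K_adm P F T S) (L1_plus P Q))"
    have "X \<in> L1 P Q" using XE Q by (auto simp: E_Phi_def)
    from separating_measure[OF U S \<Phi> Q this nX]
    obtain R where R: "R \<in> M_Phi P F T S \<Phi>" "0 < (\<integral>\<omega>. X \<omega> * density_of P R \<omega> \<partial>P)" .
    \<comment> \<open>The half-line \<open>{0<..}\<close> in the coordinate of \<open>R\<close> is a
      weak neighbourhood of \<open>X\<close>, while all elements of \<open>C_adm\<close> have a
      nonpositive coordinate there.\<close>
    have "\<exists>Z\<in>C_adm P F T S \<inter> E_Phi P F T S \<Phi>. \<forall>w\<in>{density_of P R}.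
        (\<integral>\<omega>. Z \<omega> * w \<omega> \<partial>P) \<in> {0<..}"
      by (rule conjunct2[OF X[unfolded weak_topology_closure_iff], rule_format])
        (use R density_of_in_F_Phi[OF P R(1)] in auto)
    then obtain Z where "Z \<in> C_adm P F T S" "0 < (\<integral>\<omega>. Z \<omega> * density_of P R \<omega> \<partial>P)"
      by auto
    with C_adm_expectation_nonpos[OF P R(1), of Z] show False by simp
  qed
qed

text \<open>Two approximations with error \<open>e / 2\<close> each are chained: the first comes
  from the L1(Q)-closure, the second from truncation.\<close>

lemma C_Phi_approx:
  assumes P: "prob_space P" and T: "0 \<le> T" and Q: "Q \<in> M_Phi P F T S \<Phi>"
    and X: "X \<in> C_Phi P F T S \<Phi>" and e: "e > 0"
  shows "\<exists>Z\<in>C_adm P F T S. (\<integral>\<omega>. \<bar>X \<omega> - Z \<omega>\<bar> \<partial>Q) < e"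
proof -
  interpret Q: prob_space Q using M_PhiD(1)[OF Q] .
  let ?G = "rv_diff (K_adm P F T S) (L1_plus P Q)"
  have "X \<in> L1_closure P Q ?G" using X Q by (auto simp: C_Phi_def)
  then obtain Xn where Xi: "integrable Q X" and Xn: "\<And>n::nat. Xn n \<in> ?G"
    "(\<lambda>n. \<integral>\<omega>. \<bar>X \<omega> - Xn n \<omega>\<bar> \<partial>Q) \<longlonglongrightarrow> 0"
    by (auto simp: L1_closure_def L1_def)
  have "\<forall>\<^sub>F n in sequentially. (\<integral>\<omega>. \<bar>X \<omega> - Xn n \<omega>\<bar> \<partial>Q) < e / 2"
    using order_tendstoD(2)[OF Xn(2), of "e / 2"] e by simp
  then obtain V where V: "V \<in> ?G" "(\<integral>\<omega>. \<bar>X \<omega> - V \<omega>\<bar> \<partial>Q) < e / 2"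
    using eventually_happens'[OF sequentially_bot] Xn(1) by blast
  obtain Z where Z: "Z \<in> C_adm P F T S" "(\<integral>\<omega>. \<bar>V \<omega> - Z \<omega>\<bar> \<partial>Q) < e / 2"
    using C_adm_dense[OF P T Q V(1), of "e / 2"] e by auto
  have Vi: "integrable Q V"
    using V(1) M_PhiD(4)[OF Q] by (auto simp: rv_diff_def L1_plus_def L1_def)
  have Zi: "integrable Q Z"
    using C_adm_subset_L1[OF P Q] Z(1) by (auto simp: L1_def)
  have "(\<integral>\<omega>. \<bar>X \<omega> - Z \<omega>\<bar> \<partial>Q) \<le> (\<integral>\<omega>. \<bar>X \<omega> - V \<omega>\<bar> + \<bar>V \<omega> - Z \<omega>\<bar> \<partial>Q)"
    using Xi Vi Zi by (intro integral_mono) auto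
  also have "\<dots> = (\<integral>\<omega>. \<bar>X \<omega> - V \<omega>\<bar> \<partial>Q) + (\<integral>\<omega>. \<bar>V \<omega> - Z \<omega>\<bar> \<partial>Q)"
    using Xi Vi Zi by simp
  also have "\<dots> < e" using V(2) Z(2) by simp
  finally show ?thesis using Z(1) by blast
qed

text \<open>The approximating sequence depends on \<open>Q\<close>, so the neighbourhood is fixed
  first and \<open>Q\<close> is then chosen to dominate its finitely many test functions.\<close>

lemma C_Phi_subset_weak_closure:
  assumes P: "prob_space P" and T: "0 \<le> T" and \<Phi>: "penalty_function \<Phi>"
    and ne: "M_Phi P F T S \<Phi> \<noteq> {}"
  shows "C_Phi P F T S \<Phi> \<subseteq>
    weak_topology P (E_Phi P F T S \<Phi>) (F_Phi P F T S \<Phi>) closure_of C_adm P F T S"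
proof
  fix X assume X: "X \<in> C_Phi P F T S \<Phi>"
  have XE: "X \<in> E_Phi P F T S \<Phi>"
    using X by (auto simp: C_Phi_def E_Phi_def L1_closure_def)
  show "X \<in> weak_topology P (E_Phi P F T S \<Phi>) (F_Phi P F T S \<Phi>) closure_of C_adm P F T S"
    unfolding weak_topology_closure_iff
  proof (intro conjI allI impI XE)
    fix I W assume I: "finite I" "I \<subseteq> F_Phi P F T S \<Phi>"
      and W: "\<forall>w\<in>I. open (W w) \<and> (\<integral>\<omega>. X \<omega> * w \<omega> \<partial>P) \<in> W w"
    obtain Q where Q: "Q \<in> M_Phi P F T S \<Phi>"
      and dom: "\<And>w. w \<in> I \<Longrightarrow> \<exists>c\<ge>0. AE \<omega> in P. \<bar>w \<omega>\<bar> \<le> c * density_of P Q \<omega>"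
      using F_Phi_dominated[OF P \<Phi> ne I] by metis
    have XQ: "X \<in> L1 P Q" using XE Q by (auto simp: E_Phi_def)
    have "\<exists>Z\<in>C_adm P F T S. (\<integral>\<omega>. \<bar>X \<omega> - Z \<omega>\<bar> \<partial>Q) < inverse (real (Suc n))" for n
      by (rule C_Phi_approx[OF P T Q X]) simp
    then obtain Z where Z: "\<And>n. Z n \<in> C_adm P F T S"
      "\<And>n. (\<integral>\<omega>. \<bar>X \<omega> - Z n \<omega>\<bar> \<partial>Q) < inverse (real (Suc n))"
      by metis
    have "\<forall>\<^sub>F n in sequentially. (\<integral>\<omega>. Z n \<omega> * w \<omega> \<partial>P) \<in> W w" if w: "w \<in> I" for w
    proof -
      obtain c where c: "c \<ge> 0" "AE \<omega> in P. \<bar>w \<omega>\<bar> \<le> c * density_of P Q \<omega>"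
        using dom[OF w] by blast
      have wm: "w \<in> borel_measurable P"
        using w I(2) by (auto simp: F_Phi_def L1_def L0_def)
      have "\<bar>(\<integral>\<omega>. Z n \<omega> * w \<omega> \<partial>P) - (\<integral>\<omega>. X \<omega> * w \<omega> \<partial>P)\<bar> \<le> c * inverse (real (Suc n))" for n
      proof -
        have ZQ: "Z n \<in> L1 P Q" using Z(1) C_adm_subset_L1[OF P Q] by blast
        then have D: "(\<lambda>\<omega>. X \<omega> - Z n \<omega>) \<in> L1 P Q"
          using XQ by (auto simp: L1_def L0_def)
        have "(\<integral>\<omega>. (X \<omega> - Z n \<omega>) * w \<omega> \<partial>P) = (\<integral>\<omega>. X \<omega> * w \<omega> \<partial>P) - (\<integral>\<omega>. Z n \<omega> * w \<omega> \<partial>P)"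
          using dominated_pairing(1)[OF P Q XQ wm c(2,1)] dominated_pairing(1)[OF P Q ZQ wm c(2,1)]
          by (simp add: left_diff_distrib)
        moreover have "\<bar>\<integral>\<omega>. (X \<omega> - Z n \<omega>) * w \<omega> \<partial>P\<bar> \<le> c * (\<integral>\<omega>. \<bar>X \<omega> - Z n \<omega>\<bar> \<partial>Q)"
          by (rule dominated_pairing(2)[OF P Q D wm c(2,1)])
        moreover have "\<dots> \<le> c * inverse (real (Suc n))"
          using Z(2)[of n] c(1) by (intro mult_left_mono) auto
        ultimately show ?thesis by (simp add: abs_minus_commute)
      qed
      then have "\<forall>\<^sub>F n in sequentially.
          norm ((\<integral>\<omega>. Z n \<omega> * w \<omega> \<partial>P) - (\<integral>\<omega>. X \<omega> * w \<omega> \<partial>P)) \<le> c * inverse (real (Suc n))"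
        by (intro always_eventually allI) (simp del: of_nat_Suc)
      moreover have "(\<lambda>n. c * inverse (real (Suc n))) \<longlonglongrightarrow> 0"
        using tendsto_mult_left[OF LIMSEQ_inverse_real_of_nat, of c] by simp
      ultimately have "(\<lambda>n. (\<integral>\<omega>. Z n \<omega> * w \<omega> \<partial>P) - (\<integral>\<omega>. X \<omega> * w \<omega> \<partial>P)) \<longlonglongrightarrow> 0"
        by (rule Lim_null_comparison)
      then have "(\<lambda>n. \<integral>\<omega>. Z n \<omega> * w \<omega> \<partial>P) \<longlonglongrightarrow> (\<integral>\<omega>. X \<omega> * w \<omega> \<partial>P)"
        by (rule LIM_zero_cancel)
      then show ?thesis
        by (rule topological_tendstoD) (use W w in auto)
    qed
    \<comment> \<open>Finiteness of \<open>I\<close> lets one index serve all coordinates.\<close>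
    then have "\<forall>\<^sub>F n in sequentially. \<forall>w\<in>I. (\<integral>\<omega>. Z n \<omega> * w \<omega> \<partial>P) \<in> W w"
      using I(1) by (simp add: eventually_ball_finite)
    then obtain n where "\<forall>w\<in>I. (\<integral>\<omega>. Z n \<omega> * w \<omega> \<partial>P) \<in> W w"
      using eventually_happens'[OF sequentially_bot] by blast
    moreover have "Z n \<in> E_Phi P F T S \<Phi>"
      unfolding E_Phi_def using C_adm_subset_L1[OF P] Z(1) by blast
    ultimately show "\<exists>Z\<in>C_adm P F T S \<inter> E_Phi P F T S \<Phi>. \<forall>w\<in>I. (\<integral>\<omega>. Z \<omega> * w \<omega> \<partial>P) \<in> W w"
      using Z(1) by blast
  qed
qed

theorem theorem7p2:
  fixes P :: "'a measure" and F :: "real \<Rightarrow> 'a measure" and T :: real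
    and S :: "real \<Rightarrow> 'a \<Rightarrow> real ^ 'd" and \<Phi> :: "real \<Rightarrow> ereal"
  assumes "0 \<le> T"
    and "usual_conditions P F T"
    and "semimartingale P F T S"
    and "penalty_function \<Phi>"
    and "growth_condition \<Phi>"
    and "M_Phi P F T S \<Phi> \<noteq> {}"
  shows "C_Phi P F T S \<Phi> =
    weak_topology P (E_Phi P F T S \<Phi>) (F_Phi P F T S \<Phi>) closure_of C_adm P F T S"
proof
  have "prob_space P" using assms(2) by (simp add: usual_conditions_def)
  then show "C_Phi P F T S \<Phi> \<subseteq>
      weak_topology P (E_Phi P F T S \<Phi>) (F_Phi P F T S \<Phi>) closure_of C_adm P F T S"
    using assms by (intro C_Phi_subset_weak_closure)
  show "weak_topology P (E_Phi P F T S \<Phi>) (F_Phi P F T S \<Phi>) closure_of C_adm P F T S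
      \<subseteq> C_Phi P F T S \<Phi>"
    using assms by (intro weak_closure_C_adm_subset semimartingale_adapted_cadlag)
qed

end
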